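(* Let $$M_1=\{(z,w)\in\mathbb C^3\times\mathbb C:\ \rho_1:=\operatorname{Im}w+|z_1|^2-|z_2|^2-|z_3|^2=0\},$$ $$M_2=\{(Z,W)\in\mathbb C^4\times\mathbb C:\ \rho_2:=\operatorname{Im}W+|Z_1|^2-|Z_2|^2-|Z_3|^2-|Z_4|^2+2|Z_1|^2|Z_2|^2=0\}.$$ Let $\lambda\in\mathbb C$, $\lambda\neq0$, and set $f_1=\dfrac{z_1}{\sqrt2\,(z_2+\lambda)}$. Near the origin of $\mathbb C^4$ and of $\mathbb C^5$ respectively, $M_1$ and $M_2$ are real-analytic Levi-nondegenerate hypersurfaces of the same signature $\ell=1$. Consider the map $$F=\left(f_1,\ \frac{2(z_2+\lambda)}{1-iw+2z_2\overline\lambda+|\lambda|^2}f_1,\ \frac{2z_3}{1-iw+2z_2\overline\lambda+|\lambda|^2}f_1,\ \frac{1+iw-2z_2\overline\lambda-|\lambda|^2}{1-iw+2z_2\overline\lambda+|\lambda|^2}f_1,\ 0\right),$$ which is holomorphic in a neighborhood of $0\in\mathbb C^4$. In a neighborhood of $0$ one has $$\rho_2\circ F=\frac{2|z_1|^2}{|z_2+\lambda|^2\,\bigl|1-iw+2z_2\overline\lambda+|\lambda|^2\bigr|^2}\cdot\rho_1 .$$ Hence, near $0$, $F$ maps $M_1$ into $M_2$, while $F$ is neither CR transversal to $M_2$ at $0$ nor totally degenerate. In particular, the following assertion (conjectured by Baouendi and Huang) is false in general: if $M_1\subset\mathbb C^n$ and $M_2\subset\mathbb C^N$ are connected, Levi-nondegenerate,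 real-analytic hypersurfaces of the same signature $\ell$, with $0<\ell\le(n-1)/2$ and $3\le n\le N$, and $F$ is a holomorphic map defined in a neighborhood of $M_1$ with $F(M_1)\subset M_2$, then either $F$ is a local CR embedding of $M_1$ into $M_2$, or $F$ maps a neighborhood of $M_1$ in $\mathbb C^n$ into $M_2$.
   Context: A Levi-nondegenerate real hypersurface $M\subset\mathbb C^n$ has signature $\ell$ (with $\ell\le (n-1)/2$) if, at each of its points, after possibly replacing a local defining function $\rho$ by $-\rho$, the Levi form (a nondegenerate Hermitian form on the $(n-1)$-dimensional space $T^{1,0}M$) has exactly $\ell$ negative and $n-1-\ell$ positive eigenvalues. Let $M_1\subset\mathbb C^n$ and $M_2\subset\mathbb C^N$ be smooth real hypersurfaces, $p\in M_1$, and let $F$ be a holomorphic map from a neighborhood of $p$ in $\mathbb C^n$ to $\mathbb C^N$ sending $M_1$ (near $p$) into $M_2$. Then: - $F$ is CR transversal to $M_2$ at $p$ if $T^{1,0}_{F(p)}M_2+dF_p\bigl(T^{1,0}_p\mathbb C^n\bigr)=T^{1,0}_{F(p)}\mathbb C^N$. Here $T^{1,0}_qM_2$ is the space of $(1,0)$-vectors at $q$ tangent to $M_2$. - $F$ is totally degenerate (near $p$) if it maps some neighborhood of $p$ in $\mathbb C^n$ into $M_2$. - $F$ is a local CR embedding of $M_1$ into $M_2$ if every point of $M_1$ has a neighborhood $V$ such that the restriction of $F$ to $M_1\cap V$ is a smooth embedding into $M_2$ which is a CR diffeomorphism onto its image, the image being a CR submanifold of $M_2$. *)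

theory Defs
  imports "HOL-Analysis.Analysis"
begin

section \<open>Holomorphic, smooth and real-analytic maps in several variables\<close>

definition holomorphic_map_on :: "(complex^'n \<Rightarrow> complex^'m) \<Rightarrow> (complex^'n) set \<Rightarrow> bool" where
  "holomorphic_map_on F U \<longleftrightarrow> open U \<and>
     (\<forall>x\<in>U. \<exists>D. (F has_derivative D) (at x) \<and> (\<forall>c v. D (c *s v) = c *s D v))"

text \<open>On an open subset of a finite-dimensional space, continuity of all iterated directional
  derivatives is equivalent to continuity of all iterated Frechet derivatives.\<close>

primrec Ck_on :: "nat \<Rightarrow> ('a::real_normed_vector \<Rightarrow> 'b::real_normed_vector) \<Rightarrow> 'a set \<Rightarrow> bool" where
  "Ck_on 0 f U \<longleftrightarrow> continuous_on U f"
| "Ck_on (Suc k) f U \<longleftrightarrow> (\<forall>x\<in>U. f differentiable (at x)) \<and>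
     (\<forall>v. Ck_on k (\<lambda>x. frechet_derivative f (at x) v) U)"

definition smooth_map_on :: "('a::real_normed_vector \<Rightarrow> 'b::real_normed_vector) \<Rightarrow> 'a set \<Rightarrow> bool" where
  "smooth_map_on f U \<longleftrightarrow> open U \<and> (\<forall>k. Ck_on k f U)"

text \<open>Local expansion into a power series in the real coordinates. The multi-indices are the
  functions \<open>\<alpha>\<close> on the standard basis, and \<open>has_sum\<close> is unconditional (absolute) convergence.\<close>

definition real_analytic_on :: "('a::euclidean_space \<Rightarrow> real) \<Rightarrow> 'a set \<Rightarrow> bool" where
  "real_analytic_on f U \<longleftrightarrow> open U \<and>
     (\<forall>x\<in>U. \<exists>r>0. \<exists>c :: ('a \<Rightarrow> nat) \<Rightarrow> real. \<forall>y\<in>ball x r.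
        ((\<lambda>\<alpha>. c \<alpha> * (\<Prod>b\<in>Basis. ((y - x) \<bullet> b) ^ \<alpha> b)) has_sum f y)
          (Basis \<rightarrow>\<^sub>E (UNIV :: nat set)))"

section \<open>Submanifolds and tangent vectors\<close>

text \<open>The variable \<open>L\<close> below is a real linear subspace of dimension \<open>d\<close> (slice charts).\<close>

definition smooth_submanifold :: "nat \<Rightarrow> ('a::euclidean_space) set \<Rightarrow> bool" where
  "smooth_submanifold d S \<longleftrightarrow>
     (\<forall>q\<in>S. \<exists>U W \<phi> \<psi> (L :: 'a set). q \<in> U \<and> smooth_map_on \<phi> U \<and> smooth_map_on \<psi> W \<and>
        homeomorphism U W \<phi> \<psi> \<and> subspace L \<and> dim L = d \<and> \<phi> ` (S \<inter> U) = L \<inter> W)"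

text \<open>Velocities of curves in \<open>S\<close>. For an embedded submanifold, curves differentiable at the one
  point \<open>0\<close> and smooth curves give the same space.\<close>

definition tangent_space :: "('a::real_normed_vector) set \<Rightarrow> 'a \<Rightarrow> 'a set" where
  "tangent_space S q = {v. \<exists>\<gamma> :: real \<Rightarrow> 'a. \<gamma> 0 = q \<and> (\<forall>\<^sub>F t in nhds 0. \<gamma> t \<in> S) \<and>
     (\<gamma> has_vector_derivative v) (at 0)}"

text \<open>The \<open>(1,0)\<close>-vector \<open>\<Sum>j. v\<^sub>j \<partial>/\<partial>z\<^sub>j = (v - \<i> J v)/2\<close> is identified with its coordinate vector
  \<open>v\<close>; it lies in the complexified tangent space of \<open>S\<close> iff \<open>v\<close> and \<open>J v = \<i> v\<close> are tangent to \<open>S\<close>.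
  Under this identification the differential of a holomorphic map acts on \<open>(1,0)\<close>-vectors as its
  Frechet derivative.\<close>

definition T10 :: "(complex^'n) set \<Rightarrow> complex^'n \<Rightarrow> (complex^'n) set" where
  "T10 S q = {v. v \<in> tangent_space S q \<and> \<i> *s v \<in> tangent_space S q}"

definition CR_submanifold :: "(complex^'n) set \<Rightarrow> bool" where
  "CR_submanifold S \<longleftrightarrow> (\<exists>d. smooth_submanifold d S) \<and> (\<exists>c. \<forall>q\<in>S. vec.dim (T10 S q) = c)"

section \<open>Real-analytic hypersurfaces, Levi form and signature\<close>

definition local_defining_function ::
    "(complex^'n) set \<Rightarrow> (complex^'n) set \<Rightarrow> (complex^'n \<Rightarrow> real) \<Rightarrow> bool" where
  "local_defining_function M U \<rho> \<longleftrightarrow> real_analytic_on \<rho> U \<and> M \<inter> U = {x\<in>U. \<rho> x = 0} \<and>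
     (\<forall>x\<in>M \<inter> U. frechet_derivative \<rho> (at x) \<noteq> (\<lambda>v. 0))"

definition real_analytic_hypersurface :: "(complex^'n) set \<Rightarrow> bool" where
  "real_analytic_hypersurface M \<longleftrightarrow> (\<forall>p\<in>M. \<exists>U \<rho>. p \<in> U \<and> local_defining_function M U \<rho>)"

text \<open>Wirtinger derivatives \<open>\<partial>/\<partial>z\<^sub>j\<close> and \<open>\<partial>/\<partial>\<close>(conjugate of \<open>z\<^sub>j\<close>).\<close>

definition wirtinger :: "'n::finite \<Rightarrow> (complex^'n \<Rightarrow> complex) \<Rightarrow> complex^'n \<Rightarrow> complex" where
  "wirtinger j g x =
     (frechet_derivative g (at x) (axis j 1) - \<i> * frechet_derivative g (at x) (axis j \<i>)) / 2"

definition wirtinger_bar :: "'n::finite \<Rightarrow> (complex^'n \<Rightarrow> complex) \<Rightarrow> complex^'n \<Rightarrow> complex" where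
  "wirtinger_bar j g x =
     (frechet_derivative g (at x) (axis j 1) + \<i> * frechet_derivative g (at x) (axis j \<i>)) / 2"

definition levi_form ::
    "(complex^'n \<Rightarrow> real) \<Rightarrow> complex^'n \<Rightarrow> complex^'n \<Rightarrow> complex^'n \<Rightarrow> complex" where
  "levi_form \<rho> p v u =
     (\<Sum>j\<in>UNIV. \<Sum>k\<in>UNIV.
        wirtinger j (wirtinger_bar k (\<lambda>x. complex_of_real (\<rho> x))) p * v $ j * cnj (u $ k))"

definition herm_inner :: "complex^'n \<Rightarrow> complex^'n \<Rightarrow> complex" where
  "herm_inner v u = (\<Sum>j\<in>UNIV. v $ j * cnj (u $ j))"

text \<open>Eigenvalues of a Hermitian form \<open>h\<close> on a complex subspace \<open>V\<close>, i.e. those of its matrix in an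
  orthonormal basis of \<open>V\<close>. The numbers of positive and negative ones do not depend on the choice
  of the inner product (Sylvester).\<close>

definition form_eigenspace ::
    "(complex^'n \<Rightarrow> complex^'n \<Rightarrow> complex) \<Rightarrow> (complex^'n) set \<Rightarrow> real \<Rightarrow> (complex^'n) set" where
  "form_eigenspace h V \<mu> = {v\<in>V. \<forall>u\<in>V. h v u = complex_of_real \<mu> * herm_inner v u}"

definition eigenvalue_count ::
    "(complex^'n \<Rightarrow> complex^'n \<Rightarrow> complex) \<Rightarrow> (complex^'n) set \<Rightarrow> real set \<Rightarrow> nat" where
  "eigenvalue_count h V A =
     (\<Sum>\<mu>\<in>{\<mu>\<in>A. form_eigenspace h V \<mu> \<noteq> {0}}. vec.dim (form_eigenspace h V \<mu>))"

text \<open>Two local defining functions at a point differ by a nonvanishing real factor, and on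
  \<open>T10 M p\<close> their Levi forms differ by the value of that factor at \<open>p\<close>. So in the next two
  definitions it does not matter which local defining function is used, up to the sign that
  the second one allows for.\<close>

definition levi_nondegenerate :: "(complex^'n) set \<Rightarrow> bool" where
  "levi_nondegenerate M \<longleftrightarrow>
     (\<forall>p\<in>M. \<exists>U \<rho>. p \<in> U \<and> local_defining_function M U \<rho> \<and>
        (\<forall>v\<in>T10 M p. (\<forall>u\<in>T10 M p. levi_form \<rho> p v u = 0) \<longrightarrow> v = 0))"

definition has_signature :: "(complex^'n) set \<Rightarrow> nat \<Rightarrow> bool" where
  "has_signature M l \<longleftrightarrow> real l \<le> (real CARD('n) - 1) / 2 \<and>
     (\<forall>p\<in>M. \<exists>U \<rho>. p \<in> U \<and> local_defining_function M U \<rho> \<and>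
        (\<exists>\<sigma>\<in>{\<rho>, \<lambda>x. - \<rho> x}.
           eigenvalue_count (levi_form \<sigma> p) (T10 M p) {..<0} = l \<and>
           eigenvalue_count (levi_form \<sigma> p) (T10 M p) {0<..} = CARD('n) - 1 - l))"

section \<open>Properties of holomorphic maps between hypersurfaces\<close>

definition CR_transversal_at ::
    "(complex^'n \<Rightarrow> complex^'m) \<Rightarrow> (complex^'m) set \<Rightarrow> complex^'n \<Rightarrow> bool" where
  "CR_transversal_at F M p \<longleftrightarrow>
     {a + b | a b. a \<in> T10 M (F p) \<and> b \<in> range (frechet_derivative F (at p))} = UNIV"

definition totally_degenerate_at ::
    "(complex^'n \<Rightarrow> complex^'m) \<Rightarrow> (complex^'m) set \<Rightarrow> complex^'n \<Rightarrow> bool" where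
  "totally_degenerate_at F M p \<longleftrightarrow> (\<exists>U. open U \<and> p \<in> U \<and> F ` U \<subseteq> M)"

text \<open>Smooth embedding: injective immersion that is a homeomorphism onto its image (its inverse is
  then smooth). CR diffeomorphism: the differential maps the \<open>(1,0)\<close>-vectors onto those of the
  image, and sends \<open>(1,0)\<close>-vectors to \<open>(1,0)\<close>-vectors, i.e. commutes with \<open>J\<close> on them.\<close>

definition local_CR_embedding ::
    "(complex^'n \<Rightarrow> complex^'m) \<Rightarrow> (complex^'n) set \<Rightarrow> (complex^'m) set \<Rightarrow> bool" where
  "local_CR_embedding F M M' \<longleftrightarrow>
     (\<forall>p\<in>M. \<exists>V. p \<in> V \<and> smooth_map_on F V \<and>
        F ` (M \<inter> V) \<subseteq> M' \<and>
        (\<exists>G. homeomorphism (M \<inter> V) (F ` (M \<inter> V)) F G) \<and>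
        (\<forall>x\<in>M \<inter> V. inj_on (frechet_derivative F (at x)) (tangent_space M x)) \<and>
        CR_submanifold (F ` (M \<inter> V)) \<and>
        (\<forall>x\<in>M \<inter> V.
           frechet_derivative F (at x) ` T10 M x = T10 (F ` (M \<inter> V)) (F x) \<and>
           (\<forall>v\<in>T10 M x. frechet_derivative F (at x) (\<i> *s v) = \<i> *s frechet_derivative F (at x) v)))"

text \<open>The conjectured assertion for \<open>n = CARD('n)\<close> and \<open>N = CARD('m)\<close>. The set \<open>\<Omega>\<close> is the
  domain of \<open>F\<close>.\<close>

definition baouendi_huang_assertion :: "'n::finite itself \<Rightarrow> 'm::finite itself \<Rightarrow> bool" where
  "baouendi_huang_assertion _ _ \<longleftrightarrow>
     (\<forall>(M :: (complex^'n) set) (M' :: (complex^'m) set) l F \<Omega>.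
        real_analytic_hypersurface M \<and> connected M \<and> levi_nondegenerate M \<and> has_signature M l \<and>
        real_analytic_hypersurface M' \<and> connected M' \<and> levi_nondegenerate M' \<and> has_signature M' l \<and>
        0 < l \<and> real l \<le> (real CARD('n) - 1) / 2 \<and> 3 \<le> CARD('n) \<and> CARD('n) \<le> CARD('m) \<and>
        M \<subseteq> \<Omega> \<and> holomorphic_map_on F \<Omega> \<and> F ` M \<subseteq> M' \<longrightarrow>
        local_CR_embedding F M M' \<or>
        (\<exists>U. open U \<and> M \<subseteq> U \<and> U \<subseteq> \<Omega> \<and> F ` U \<subseteq> M'))"

section \<open>The example\<close>

text \<open>A point \<open>(z, w)\<close> of the source is \<open>x\<close> with \<open>z\<^sub>j = x $ j\<close> for \<open>j \<le> 3\<close> and \<open>w = x $ 4\<close>; a point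
  \<open>(Z, W)\<close> of the target is \<open>X\<close> with \<open>Z\<^sub>j = X $ j\<close> for \<open>j \<le> 4\<close> and \<open>W = X $ 5\<close>.\<close>

definition rho1 :: "complex^4 \<Rightarrow> real" where
  "rho1 x = Im (x $ 4) + (cmod (x $ 1))\<^sup>2 - (cmod (x $ 2))\<^sup>2 - (cmod (x $ 3))\<^sup>2"

definition rho2 :: "complex^5 \<Rightarrow> real" where
  "rho2 X = Im (X $ 5) + (cmod (X $ 1))\<^sup>2 - (cmod (X $ 2))\<^sup>2 - (cmod (X $ 3))\<^sup>2 - (cmod (X $ 4))\<^sup>2
     + 2 * (cmod (X $ 1))\<^sup>2 * (cmod (X $ 2))\<^sup>2"

definition M1 :: "(complex^4) set" where "M1 = {x. rho1 x = 0}"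

definition M2 :: "(complex^5) set" where "M2 = {X. rho2 X = 0}"

definition denom :: "complex \<Rightarrow> complex^4 \<Rightarrow> complex" where
  "denom lam x = 1 - \<i> * x $ 4 + 2 * x $ 2 * cnj lam + complex_of_real ((cmod lam)\<^sup>2)"

definition f1 :: "complex \<Rightarrow> complex^4 \<Rightarrow> complex" where
  "f1 lam x = x $ 1 / (complex_of_real (sqrt 2) * (x $ 2 + lam))"

definition Fmap :: "complex \<Rightarrow> complex^4 \<Rightarrow> complex^5" where
  "Fmap lam x = vector
     [f1 lam x,
      2 * (x $ 2 + lam) / denom lam x * f1 lam x,
      2 * x $ 3 / denom lam x * f1 lam x,
      (1 + \<i> * x $ 4 - 2 * x $ 2 * cnj lam - complex_of_real ((cmod lam)\<^sup>2)) / denom lam x * f1 lam x,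
      0]"

end

theory Submission
  imports Defs
begin

text \<open>
  Write \<open>D\<close> for the common denominator. In \<open>\<rho>\<^sub>2 \<circ> F\<close> every term contains the factor
  \<open>\<bar>f\<^sub>1\<bar>\<^sup>2/\<bar>D\<bar>\<^sup>2\<close>. The first and fourth components have the form \<open>f\<^sub>1\<close> and \<open>f\<^sub>1(1 - A)/(1 + A)\<close> with
  \<open>D = 1 + A\<close>, and \<open>\<bar>1 + A\<bar>\<^sup>2 - \<bar>1 - A\<bar>\<^sup>2 = 4 Re A\<close>; completing the square in \<open>z\<^sub>2 + \<lambda>\<close> turns the rest
  into \<open>4\<rho>\<^sub>1\<close>, where the quartic term of \<open>\<rho>\<^sub>2\<close> supplies exactly the missing \<open>\<bar>z\<^sub>1\<bar>\<^sup>2\<close>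
  (\<open>rho2_Fmap\<close>). The factor in front of \<open>\<rho>\<^sub>1\<close> vanishes only on \<open>z\<^sub>1 = 0\<close>, so \<open>F\<close> is not totally
  degenerate. The last component of \<open>F\<close> is zero while \<open>T\<^sup>1\<^sup>0 M\<^sub>2\<close> at the origin is \<open>W = 0\<close>, so \<open>F\<close> is
  not transversal there. Finally, \<open>F\<close> collapses \<open>z\<^sub>1 = 0\<close> to the origin, hence is injective on no
  neighbourhood of \<open>0\<close> in \<open>M\<^sub>1\<close>. This refutes the general assertion: take \<open>\<lambda> = 1\<close> and cut \<open>M\<^sub>1\<close> and
  \<open>M\<^sub>2\<close> by cylinders small enough that \<open>F\<close> maps one piece into the other.

  The signature is that of \<open>-\<rho>\<^sub>1\<close> and \<open>-\<rho>\<^sub>2\<close>. Both hypersurfaces are graphs of \<open>Im w\<close> over the other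
  coordinates, so their \<open>(1,0)\<close>-tangent spaces are graphs as well, tilted by an amount that
  depends on the point (\<open>T10_level_set\<close>). Explicit eigenvalues of the restricted Levi form are
  therefore inconvenient. Instead, the form is negative on the tangent vectors whose
  coordinates other than the first and the last vanish, and positive on those whose first
  coordinate vanishes, and by Sylvester's law the
  dimensions of two such complementary subspaces count the eigenvalues (\<open>inertia\<close>). This rests on
  the spectral theorem for a Hermitian form on a subspace (\<open>eigenbasis_exists\<close>), proved by
  maximizing the Rayleigh quotient.
\<close>

section \<open>Polynomials are real-analytic\<close>

definition taylor_monomial :: "'a::euclidean_space \<Rightarrow> ('a \<Rightarrow> nat) \<Rightarrow> 'a \<Rightarrow> real" where
  "taylor_monomial x \<alpha> y = (\<Prod>b\<in>Basis. ((y - x) \<bullet> b) ^ \<alpha> b)"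

text \<open>Finite sums, unlike convergent series, are multiplied term by term without any analysis; for
  the polynomials at hand they suffice.\<close>

definition finite_expansion_at :: "'a::euclidean_space \<Rightarrow> ('a \<Rightarrow> real) \<Rightarrow> bool" where
  "finite_expansion_at x f \<longleftrightarrow> (\<exists>S c. finite S \<and> S \<subseteq> Basis \<rightarrow>\<^sub>E (UNIV :: nat set) \<and>
     (\<forall>y. f y = (\<Sum>\<alpha>\<in>S. c \<alpha> * taylor_monomial x \<alpha> y)))"

lemma finite_expansion_at_monomial:
  "finite_expansion_at x (\<lambda>y. r * taylor_monomial x \<alpha> y)"
proof -
  have "taylor_monomial x (restrict \<alpha> Basis) = taylor_monomial x \<alpha>"
    by (simp add: taylor_monomial_def fun_eq_iff)
  then show ?thesis
    unfolding finite_expansion_at_def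
    by (intro exI[of _ "{restrict \<alpha> Basis}"] exI[of _ "\<lambda>_. r"]) auto
qed

lemma finite_expansion_at_const: "finite_expansion_at x (\<lambda>y. r)"
  using finite_expansion_at_monomial[of x r "\<lambda>_. 0"] by (simp add: taylor_monomial_def)

lemma finite_expansion_at_coord:
  assumes "b \<in> Basis"
  shows "finite_expansion_at x (\<lambda>y. r * ((y - x) \<bullet> b))"
proof -
  have "taylor_monomial x (\<lambda>b'. if b' = b then 1 else 0) y = (y - x) \<bullet> b" for y
    using assms by (simp add: taylor_monomial_def if_distrib prod.delta cong: if_cong)
  then show ?thesis
    using finite_expansion_at_monomial[of x r "\<lambda>b'. if b' = b then 1 else 0"] by simp
qed

lemma finite_expansion_at_add:
  assumes "finite_expansion_at x f" "finite_expansion_at x g"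
  shows "finite_expansion_at x (\<lambda>y. f y + g y)"
proof -
  obtain S c T d where S: "finite S" "S \<subseteq> Basis \<rightarrow>\<^sub>E (UNIV :: nat set)"
      "\<And>y. f y = (\<Sum>\<alpha>\<in>S. c \<alpha> * taylor_monomial x \<alpha> y)"
    and T: "finite T" "T \<subseteq> Basis \<rightarrow>\<^sub>E (UNIV :: nat set)"
      "\<And>y. g y = (\<Sum>\<alpha>\<in>T. d \<alpha> * taylor_monomial x \<alpha> y)"
    using assms unfolding finite_expansion_at_def by blast
  let ?c = "\<lambda>\<alpha>. (if \<alpha> \<in> S then c \<alpha> else 0) + (if \<alpha> \<in> T then d \<alpha> else 0)"
  have "f y + g y = (\<Sum>\<alpha>\<in>S \<union> T. ?c \<alpha> * taylor_monomial x \<alpha> y)" for y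
  proof -
    have "f y = (\<Sum>\<alpha>\<in>S \<union> T. (if \<alpha> \<in> S then c \<alpha> else 0) * taylor_monomial x \<alpha> y)"
      unfolding S(3) by (rule sum.mono_neutral_cong_left) (use S T in auto)
    moreover have "g y = (\<Sum>\<alpha>\<in>S \<union> T. (if \<alpha> \<in> T then d \<alpha> else 0) * taylor_monomial x \<alpha> y)"
      unfolding T(3) by (rule sum.mono_neutral_cong_left) (use S T in auto)
    ultimately show ?thesis
      by (simp only: sum.distrib[symmetric] distrib_right)
  qed
  then show ?thesis
    unfolding finite_expansion_at_def
    by (intro exI[of _ "S \<union> T"] exI[of _ ?c]) (use S T in auto)
qed

lemma finite_expansion_at_sum:
  assumes "\<And>i. i \<in> I \<Longrightarrow> finite_expansion_at x (f i)"
  shows "finite_expansion_at x (\<lambda>y. \<Sum>i\<in>I. f i y)"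
  using assms
  by (induction I rule: infinite_finite_induct)
     (auto intro: finite_expansion_at_add finite_expansion_at_const)

lemma finite_expansion_at_mult:
  assumes "finite_expansion_at x f" "finite_expansion_at x g"
  shows "finite_expansion_at x (\<lambda>y. f y * g y)"
proof -
  obtain S c T d where S: "\<And>y. f y = (\<Sum>\<alpha>\<in>S. c \<alpha> * taylor_monomial x \<alpha> y)"
    and T: "\<And>y. g y = (\<Sum>\<alpha>\<in>T. d \<alpha> * taylor_monomial x \<alpha> y)"
    using assms unfolding finite_expansion_at_def by blast
  have "f y * g y =
      (\<Sum>\<alpha>\<in>S. \<Sum>\<beta>\<in>T. (c \<alpha> * d \<beta>) * taylor_monomial x (\<lambda>b. \<alpha> b + \<beta> b) y)" for y
    unfolding S T sum_product
    by (intro sum.cong refl) (simp add: taylor_monomial_def power_add prod.distrib mult_ac)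
  then show ?thesis
    by (simp add: finite_expansion_at_sum finite_expansion_at_monomial)
qed

lemma finite_expansion_at_linear:
  fixes f :: "'a::euclidean_space \<Rightarrow> real"
  assumes "bounded_linear f"
  shows "finite_expansion_at x f"
proof -
  interpret bounded_linear f by fact
  have "f y = f x + (\<Sum>b\<in>Basis. f b * ((y - x) \<bullet> b))" for y
  proof -
    have "f (y - x) = f (\<Sum>b\<in>Basis. ((y - x) \<bullet> b) *\<^sub>R b)"
      by (simp only: euclidean_representation)
    also have "\<dots> = (\<Sum>b\<in>Basis. f b * ((y - x) \<bullet> b))"
      by (simp only: sum scaleR) (simp add: mult.commute)
    finally show ?thesis by (simp add: diff)
  qed
  moreover have "finite_expansion_at x (\<lambda>y. f x + (\<Sum>b\<in>Basis. f b * ((y - x) \<bullet> b)))"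
    by (intro finite_expansion_at_add finite_expansion_at_const finite_expansion_at_sum
        finite_expansion_at_coord)
  moreover from calculation(1) have "f = (\<lambda>y. f x + (\<Sum>b\<in>Basis. f b * ((y - x) \<bullet> b)))"
    by blast
  ultimately show ?thesis by metis
qed

lemma real_analytic_on_polynomial:
  fixes f :: "'a::euclidean_space \<Rightarrow> real"
  assumes "real_polynomial_function f" "open U"
  shows "real_analytic_on f U"
proof -
  have "finite_expansion_at x f" for x
    using assms(1)
    by induction (auto intro: finite_expansion_at_linear finite_expansion_at_const
        finite_expansion_at_add finite_expansion_at_mult)
  moreover have "\<exists>c :: ('a \<Rightarrow> nat) \<Rightarrow> real. \<forall>y.
        ((\<lambda>\<alpha>. c \<alpha> * (\<Prod>b\<in>Basis. ((y - x) \<bullet> b) ^ \<alpha> b)) has_sum f y)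
          (Basis \<rightarrow>\<^sub>E (UNIV :: nat set))" if x: "finite_expansion_at x f" for x
  proof -
    obtain S c where S: "finite S" "S \<subseteq> Basis \<rightarrow>\<^sub>E (UNIV :: nat set)"
      "\<And>y. f y = (\<Sum>\<alpha>\<in>S. c \<alpha> * taylor_monomial x \<alpha> y)"
      using x unfolding finite_expansion_at_def by blast
    let ?c = "\<lambda>\<alpha>. if \<alpha> \<in> S then c \<alpha> else 0"
    have "((\<lambda>\<alpha>. ?c \<alpha> * taylor_monomial x \<alpha> y) has_sum f y) (Basis \<rightarrow>\<^sub>E (UNIV :: nat set))" for y
    proof -
      have "((\<lambda>\<alpha>. c \<alpha> * taylor_monomial x \<alpha> y) has_sum f y) S"
        unfolding S(3) by (rule has_sum_finite[OF S(1)])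
      then show ?thesis
        by (rule has_sum_cong_neutral[THEN iffD1, rotated -1]) (use S in auto)
    qed
    then show ?thesis
      unfolding taylor_monomial_def by (intro exI[of _ ?c]) blast
  qed
  ultimately have expansion: "\<exists>c :: ('a \<Rightarrow> nat) \<Rightarrow> real. \<forall>y.
        ((\<lambda>\<alpha>. c \<alpha> * (\<Prod>b\<in>Basis. ((y - x) \<bullet> b) ^ \<alpha> b)) has_sum f y)
          (Basis \<rightarrow>\<^sub>E (UNIV :: nat set))" for x
    by blast
  show ?thesis
    unfolding real_analytic_on_def
  proof (intro conjI assms(2) ballI exI[of _ "1::real"])
    fix x
    obtain c where "\<forall>y. ((\<lambda>\<alpha>. c \<alpha> * (\<Prod>b\<in>Basis. ((y - x) \<bullet> b) ^ \<alpha> b)) has_sum f y)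
          (Basis \<rightarrow>\<^sub>E (UNIV :: nat set))"
      using expansion by blast
    then show "\<exists>c :: ('a \<Rightarrow> nat) \<Rightarrow> real. \<forall>y\<in>ball x 1.
        ((\<lambda>\<alpha>. c \<alpha> * (\<Prod>b\<in>Basis. ((y - x) \<bullet> b) ^ \<alpha> b)) has_sum f y)
          (Basis \<rightarrow>\<^sub>E (UNIV :: nat set))"
      by blast
  qed simp
qed

section \<open>Tangent spaces of graphs\<close>

text \<open>A level set of a function that increases at unit speed along \<open>e\<close> is a graph over any complement
  of \<open>e\<close>. Moving a straight line back along \<open>e\<close> puts it on the level set, so every vector in the
  kernel of the derivative is the velocity of a curve in the level set.\<close>

lemma tangent_space_level_set:
  fixes \<rho> :: "'a::real_normed_vector \<Rightarrow> real"
  assumes D: "(\<rho> has_derivative D) (at q)" and q: "\<rho> q = 0" "q \<in> U" "open U"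
    and shift: "\<And>x s. \<rho> (x + s *\<^sub>R e) = \<rho> x + s"
  shows "tangent_space ({x. \<rho> x = 0} \<inter> U) q = {v. D v = 0}"
proof (intro set_eqI iffI; clarsimp simp: tangent_space_def)
  fix v \<gamma>
  assume \<gamma>: "q = \<gamma> (0::real)" "\<forall>\<^sub>F t in nhds 0. \<rho> (\<gamma> t) = 0 \<and> \<gamma> t \<in> U"
    "(\<gamma> has_vector_derivative v) (at 0)"
  interpret D: bounded_linear D using D by (rule has_derivative_bounded_linear)
  have "(\<rho> \<circ> \<gamma> has_derivative D \<circ> (\<lambda>t. t *\<^sub>R v)) (at 0)"
    using \<gamma>(3) D unfolding has_vector_derivative_def \<gamma>(1) by (rule diff_chain_at)
  moreover have "(\<rho> \<circ> \<gamma> has_derivative (\<lambda>_. 0)) (at 0)"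
  proof (rule has_derivative_transform_eventually[of "\<lambda>_. 0"])
    show "\<forall>\<^sub>F t in at 0. 0 = (\<rho> \<circ> \<gamma>) t"
      using \<gamma>(2) unfolding eventually_at_filter by (auto elim: eventually_mono)
  qed (use \<gamma>(1) q in auto)
  ultimately have "D \<circ> (\<lambda>t. t *\<^sub>R v) = (\<lambda>_. 0)"
    by (rule has_derivative_unique)
  then have "(D \<circ> (\<lambda>t. t *\<^sub>R v)) 1 = 0" by simp
  then show "D v = 0" by simp
next
  fix v
  assume v: "D v = 0"
  interpret D: bounded_linear D using D by (rule has_derivative_bounded_linear)
  define \<gamma> where "\<gamma> t = (q + t *\<^sub>R v) + (- \<rho> (q + t *\<^sub>R v)) *\<^sub>R e" for t
  have line: "((\<lambda>t. q + t *\<^sub>R v) has_derivative (\<lambda>t. t *\<^sub>R v)) (at 0)"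
    by (auto intro!: derivative_eq_intros)
  have "((\<lambda>t. \<rho> (q + t *\<^sub>R v)) has_derivative (\<lambda>t. D (t *\<^sub>R v))) (at 0)"
    using diff_chain_at[OF line, of \<rho> D] D by (simp add: o_def)
  then have "(\<gamma> has_vector_derivative v) (at 0)"
    unfolding has_vector_derivative_def \<gamma>_def
    by (auto intro!: derivative_eq_intros line simp: D.scaleR v)
  moreover have "\<gamma> 0 = q" by (simp add: \<gamma>_def q)
  moreover have "\<forall>\<^sub>F t in nhds 0. \<rho> (\<gamma> t) = 0 \<and> \<gamma> t \<in> U"
  proof -
    have "isCont \<gamma> 0"
      using \<open>(\<gamma> has_vector_derivative v) (at 0)\<close> by (rule has_vector_derivative_continuous)
    then have "(\<gamma> \<longlongrightarrow> \<gamma> 0) (nhds 0)"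
      by (simp only: isCont_def tendsto_at_iff_tendsto_nhds)
    then have "\<forall>\<^sub>F t in nhds 0. \<gamma> t \<in> U"
      using q \<open>\<gamma> 0 = q\<close> by (auto simp: tendsto_def)
    moreover have "\<rho> (\<gamma> t) = 0" for t unfolding \<gamma>_def shift by simp
    ultimately show ?thesis by simp
  qed
  ultimately show "\<exists>\<gamma>. \<gamma> 0 = q \<and> (\<forall>\<^sub>F t in nhds 0. \<rho> (\<gamma> t) = 0 \<and> \<gamma> t \<in> U) \<and>
      (\<gamma> has_vector_derivative v) (at 0)"
    by blast
qed

definition graph_subspace :: "'n::finite \<Rightarrow> ('n \<Rightarrow> complex) \<Rightarrow> (complex^'n) set" where
  "graph_subspace k a = {v. v $ k = (\<Sum>j\<in>UNIV - {k}. a j * v $ j)}"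

text \<open>The complex-linear functional \<open>v \<mapsto> D v - \<i> D(\<i>v)\<close>, which is \<open>2\<partial>\<rho>\<close> if \<open>D\<close> is the differential of
  \<open>\<rho>\<close>. Its kernel is the largest complex subspace of the kernel of \<open>D\<close>.\<close>

lemma complex_part_of_real_functional:
  fixes D :: "complex^'n \<Rightarrow> real"
  assumes "bounded_linear D"
  shows "Complex (D v) (- D (\<i> *s v)) =
    (\<Sum>j\<in>UNIV. Complex (D (axis j 1)) (- D (axis j \<i>)) * v $ j)"
proof -
  interpret D: bounded_linear D by fact
  have D_expand: "D u = (\<Sum>j\<in>UNIV. Re (u $ j) * D (axis j 1) + Im (u $ j) * D (axis j \<i>))" for u
  proof -
    have "u = (\<Sum>j\<in>UNIV. Re (u $ j) *\<^sub>R axis j 1 + Im (u $ j) *\<^sub>R axis j \<i>)"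
    proof (rule vec_eq_iff[THEN iffD2], rule allI)
      fix i
      have "(\<Sum>j\<in>UNIV. Re (u $ j) *\<^sub>R axis j 1 + Im (u $ j) *\<^sub>R axis j \<i>) $ i =
          (\<Sum>j\<in>UNIV. if i = j then u $ j else 0)"
        unfolding sum_component by (intro sum.cong) (auto simp: axis_def complex_eq_iff)
      then show "u $ i = (\<Sum>j\<in>UNIV. Re (u $ j) *\<^sub>R axis j 1 + Im (u $ j) *\<^sub>R axis j \<i>) $ i"
        by simp
    qed
    then have "D u = D (\<Sum>j\<in>UNIV. Re (u $ j) *\<^sub>R axis j 1 + Im (u $ j) *\<^sub>R axis j \<i>)"
      by simp
    then show ?thesis by (simp only: D.sum D.add D.scaleR) simp
  qed
  show ?thesis
    by (simp add: complex_eq_iff D_expand[of v] D_expand[of "\<i> *s v"] sum_negf[symmetric]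
        algebra_simps)
qed

lemma T10_level_set:
  fixes \<rho> :: "complex^'n \<Rightarrow> real"
  assumes D: "(\<rho> has_derivative D) (at q)" and q: "\<rho> q = 0" "q \<in> U" "open U"
    and shift: "\<And>x s. \<rho> (x + s *\<^sub>R axis k c) = \<rho> x + s"
  shows "\<exists>a. T10 ({x. \<rho> x = 0} \<inter> U) q = graph_subspace k a"
proof -
  have bl: "bounded_linear D" using D by (rule has_derivative_bounded_linear)
  define \<phi> where "\<phi> j = Complex (D (axis j 1)) (- D (axis j \<i>))" for j
  have \<phi>: "Complex (D v) (- D (\<i> *s v)) = (\<Sum>j\<in>UNIV. \<phi> j * v $ j)" for v
    unfolding \<phi>_def by (rule complex_part_of_real_functional[OF bl])
  \<comment> \<open>The derivative is nonzero along the \<open>k\<close>-th complex axis, so \<open>v $ k\<close> can be solved for.\<close>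
  have "D (axis k c) = 1"
  proof -
    have "((\<lambda>s. \<rho> (q + s *\<^sub>R axis k c)) has_derivative (\<lambda>s. D (s *\<^sub>R axis k c))) (at 0)"
    proof -
      have line: "((\<lambda>s. q + s *\<^sub>R axis k c) has_derivative (\<lambda>s. s *\<^sub>R axis k c)) (at 0)"
        by (auto intro!: derivative_eq_intros)
      show ?thesis using diff_chain_at[OF line, of \<rho> D] D by (simp add: o_def)
    qed
    moreover have "((\<lambda>s. \<rho> (q + s *\<^sub>R axis k c)) has_derivative (\<lambda>s. s)) (at 0)"
      unfolding shift by (auto intro!: derivative_eq_intros)
    ultimately have "(\<lambda>s::real. D (s *\<^sub>R axis k c)) = (\<lambda>s. s)"
      by (rule has_derivative_unique)
    then have "D (1 *\<^sub>R axis k c) = 1" by meson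
    then show ?thesis by simp
  qed
  moreover have "(\<Sum>j\<in>UNIV. \<phi> j * axis k c $ j) = \<phi> k * c"
  proof -
    have "(\<Sum>j\<in>UNIV. \<phi> j * axis k c $ j) = (\<Sum>j\<in>UNIV. if j = k then \<phi> j * c else 0)"
      by (intro sum.cong) (auto simp: axis_def)
    then show ?thesis by simp
  qed
  ultimately have nz: "\<phi> k \<noteq> 0"
    using \<phi>[of "axis k c"] by (auto simp: complex_eq_iff)
  have "v \<in> T10 ({x. \<rho> x = 0} \<inter> U) q \<longleftrightarrow> (\<Sum>j\<in>UNIV. \<phi> j * v $ j) = 0" for v
    unfolding T10_def tangent_space_level_set[OF D q shift] \<phi>[symmetric]
    by (auto simp: complex_eq_iff)
  moreover have "(\<Sum>j\<in>UNIV. \<phi> j * v $ j) = 0 \<longleftrightarrow>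
      v \<in> graph_subspace k (\<lambda>j. - \<phi> j / \<phi> k)" for v
  proof -
    have all: "(\<Sum>j\<in>UNIV. \<phi> j * v $ j) = \<phi> k * v $ k + (\<Sum>j\<in>UNIV - {k}. \<phi> j * v $ j)"
      by (rule sum.remove) auto
    have rest: "(\<Sum>j\<in>UNIV - {k}. (- \<phi> j / \<phi> k) * v $ j) =
        - (\<Sum>j\<in>UNIV - {k}. \<phi> j * v $ j) / \<phi> k"
      by (simp add: sum_divide_distrib sum_negf)
    show ?thesis
      unfolding graph_subspace_def mem_Collect_eq all rest using nz
      by (simp add: field_simps add_eq_0_iff) (metis add.inverse_inverse)
  qed
  ultimately show ?thesis by blast
qed

lemma subspace_graph_subspace: "vec.subspace (graph_subspace k a)"
  unfolding vec.subspace_def graph_subspace_def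
  by (auto simp: algebra_simps sum.distrib sum_distrib_left)

lemma subspace_graph_subspace_supported:
  "vec.subspace {v \<in> graph_subspace k a. \<forall>j. j \<notin> J \<and> j \<noteq> k \<longrightarrow> v $ j = 0}"
  using subspace_graph_subspace[of k a] unfolding vec.subspace_def by auto

text \<open>Dropping the \<open>k\<close>-th coordinate is an isomorphism from the graph to the coordinate hyperplane.\<close>

lemma dim_graph_subspace_supported:
  fixes k :: "'n::finite"
  assumes "k \<notin> J"
  shows "vec.dim {v \<in> graph_subspace k a. \<forall>j. j \<notin> J \<and> j \<noteq> k \<longrightarrow> v $ j = 0} = card J"
proof -
  define L :: "complex^'n \<Rightarrow> complex^'n" where
    "L x = (\<chi> j. if j = k then (\<Sum>i\<in>UNIV - {k}. a i * x $ i) else x $ j)" for x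
  define S :: "(complex^'n) set" where "S = {x. \<forall>i. i \<notin> J \<longrightarrow> x $ i = 0}"
  have lin: "Vector_Spaces.linear (*s) (*s) L"
    by unfold_locales
      (auto simp: L_def vec_eq_iff algebra_simps sum.distrib sum_distrib_left)
  have "vec.subspace S"
    unfolding vec.subspace_def S_def by auto
  then have span: "vec.span S = S" by simp
  have inj: "inj_on L S"
  proof (rule inj_onI)
    fix x y assume xy: "x \<in> S" "y \<in> S" "L x = L y"
    have "x $ j = y $ j" for j
    proof (cases "j = k")
      case True
      then show ?thesis using xy(1,2) assms by (simp add: S_def)
    next
      case False
      then show ?thesis using arg_cong[OF xy(3), of "\<lambda>u. u $ j"] by (simp add: L_def)
    qed
    then show "x = y" by (simp add: vec_eq_iff)
  qed
  have "L ` S = {v \<in> graph_subspace k a. \<forall>j. j \<notin> J \<and> j \<noteq> k \<longrightarrow> v $ j = 0}" (is "_ = ?V")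
  proof
    show "L ` S \<subseteq> ?V"
      by (auto simp: L_def S_def graph_subspace_def intro!: sum.cong)
    show "?V \<subseteq> L ` S"
    proof
      fix v assume v: "v \<in> ?V"
      let ?x = "\<chi> j. if j = k then 0 else v $ j"
      have "?x \<in> S" using v by (auto simp: S_def)
      moreover have "(\<Sum>i\<in>UNIV - {k}. a i * ?x $ i) = (\<Sum>i\<in>UNIV - {k}. a i * v $ i)"
        by (intro sum.cong) auto
      then have "L ?x = v"
        using v by (auto simp: L_def vec_eq_iff graph_subspace_def)
      ultimately show "v \<in> L ` S" by (metis imageI)
    qed
  qed
  then have "vec.dim ?V = vec.dim S"
    using vec.dim_image_eq[OF lin] inj span by metis
  then show ?thesis unfolding S_def by (simp add: dim_substandard_cart)
qed

section \<open>Hermitian forms on a complex subspace\<close>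

locale hermitian_form =
  fixes h :: "complex^'n \<Rightarrow> complex^'n \<Rightarrow> complex"
  assumes add_left: "h (u + v) w = h u w + h v w"
    and scale_left: "h (c *s v) w = c * h v w"
    and cnj_swap: "cnj (h v w) = h w v"
begin

lemma add_right: "h w (u + v) = h w u + h w v"
  by (metis add_left cnj_swap complex_cnj_add)

lemma scale_right: "h w (c *s v) = cnj c * h w v"
  by (metis scale_left cnj_swap complex_cnj_mult)

lemma zero_left [simp]: "h 0 w = 0"
  using scale_left[of 0 0 w] by simp

lemma zero_right [simp]: "h w 0 = 0"
  using scale_right[of w 0 0] by simp

lemma sum_left: "h (\<Sum>i\<in>I. f i) w = (\<Sum>i\<in>I. h (f i) w)"
  by (induction I rule: infinite_finite_induct) (auto simp: add_left)

lemma sum_right: "h w (\<Sum>i\<in>I. f i) = (\<Sum>i\<in>I. h w (f i))"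
  by (induction I rule: infinite_finite_induct) (auto simp: add_right)

lemma Im_diagonal: "Im (h v v) = 0"
  using cnj_swap[of v v] by (simp add: complex_eq_iff)

text \<open>The degenerate case of the Cauchy--Schwarz inequality: if \<open>c = h v u\<close> were nonzero, a small step
  from \<open>v\<close> along \<open>-c u\<close> would make the form negative.\<close>

lemma semidefinite_null_vector:
  assumes V: "vec.subspace V" and nonneg: "\<And>w. w \<in> V \<Longrightarrow> 0 \<le> Re (h w w)"
    and v: "v \<in> V" "Re (h v v) = 0" and u: "u \<in> V"
  shows "h v u = 0"
proof -
  define c where "c = h v u"
  define G where "G = Re (h u u)"
  \<comment> \<open>The form at \<open>v - t c u\<close> is \<open>t (t G - 2) \<bar>c\<bar>\<^sup>2\<close>, negative for \<open>0 < t\<close> and \<open>t G < 1\<close>.\<close>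
  define t where "t = 1 / (G + 1)"
  have "0 \<le> G" unfolding G_def using nonneg u by blast
  then have t: "0 < t" "t * G < 1" by (auto simp: t_def field_simps)
  let ?s = "complex_of_real (- t) * c"
  have "h (v + s *s u) (v + s *s u) = h v v + cnj s * c + s * cnj c + s * cnj s * h u u" for s
    unfolding c_def cnj_swap
    by (simp add: add_left add_right scale_left scale_right algebra_simps)
  then have "h (v + ?s *s u) (v + ?s *s u) =
      h v v + cnj ?s * c + ?s * cnj c + ?s * cnj ?s * h u u" .
  also have "Re \<dots> = t * (t * G - 2) * (cmod c)\<^sup>2"
    using v(2) Im_diagonal[of u] unfolding cmod_power2
    by (simp add: G_def power2_eq_square algebra_simps)
  finally have "Re (h (v + ?s *s u) (v + ?s *s u)) = t * (t * G - 2) * (cmod c)\<^sup>2" .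
  moreover have "v + ?s *s u \<in> V"
    using V v(1) u by (intro vec.subspace_add vec.subspace_scale)
  ultimately have "0 \<le> t * (t * G - 2) * (cmod c)\<^sup>2"
    using nonneg by metis
  moreover have "t * (t * G - 2) < 0" using t by (simp add: mult_pos_neg)
  ultimately have "(cmod c)\<^sup>2 \<le> 0"
    by (metis mult_neg_pos not_le)
  then show ?thesis by (simp add: c_def)
qed

lemma continuous_on_diagonal: "continuous_on S (\<lambda>v. Re (h v v))"
proof -
  have expand: "v = (\<Sum>j\<in>UNIV. v $ j *s axis j 1)" for v :: "complex^'n"
    by (rule basis_expansion[symmetric])
  have "h v v = (\<Sum>k\<in>UNIV. \<Sum>j\<in>UNIV. cnj (v $ k) * (v $ j * h (axis j 1) (axis k 1)))" for v
  proof -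
    have "h v v = h (\<Sum>j\<in>UNIV. v $ j *s axis j 1) (\<Sum>k\<in>UNIV. v $ k *s axis k 1)"
      using expand[of v] by simp
    then show ?thesis
      by (simp only: sum_left sum_right scale_left scale_right sum_distrib_left)
  qed
  then have eq: "(\<lambda>v. Re (h v v)) =
      (\<lambda>v. Re (\<Sum>k\<in>UNIV. \<Sum>j\<in>UNIV. cnj (v $ k) * (v $ j * h (axis j 1) (axis k 1))))"
    by simp
  show ?thesis unfolding eq by (intro continuous_intros)
qed

end

interpretation herm: hermitian_form herm_inner
  by unfold_locales
    (simp_all add: herm_inner_def sum.distrib sum_distrib_left algebra_simps)

lemma herm_inner_self: "herm_inner v v = complex_of_real ((norm v)\<^sup>2)"
  unfolding herm_inner_def norm_vec_def L2_set_def
  by (simp add: sum_nonneg flip: complex_norm_square)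

lemma herm_inner_self_eq_0 [simp]: "herm_inner v v = 0 \<longleftrightarrow> v = 0"
  by (simp add: herm_inner_self)

lemma scaleR_eq_vec_scale: "r *\<^sub>R v = complex_of_real r *s v" for v :: "complex^'n"
  by (simp add: vec_eq_iff complex_eq_iff)

lemma closed_vec_subspace:
  fixes V :: "(complex^'n) set"
  assumes "vec.subspace V"
  shows "closed V"
proof (rule closed_subspace)
  show "subspace V"
    using assms by (auto simp: subspace_def vec.subspace_def scaleR_eq_vec_scale)
qed

context hermitian_form
begin

text \<open>Let \<open>v\<close> maximize the form on the unit sphere of \<open>V\<close>, and let \<open>\<mu>\<close> be the maximum. Then
  \<open>\<mu>\<langle>\<cdot>,\<cdot>\<rangle> - h\<close> is positive semidefinite on \<open>V\<close> with null vector \<open>v\<close>, which is to say that \<open>v\<close> is an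
  eigenvector for \<open>\<mu>\<close>.\<close>

lemma eigenvector_exists:
  assumes V: "vec.subspace V" and ne: "V \<noteq> {0}"
  shows "\<exists>v\<in>V. \<exists>\<mu>. v \<noteq> 0 \<and> v \<in> form_eigenspace h V \<mu>"
proof -
  have "0 \<in> V" using V by (rule vec.subspace_0)
  then obtain w where w: "w \<in> V" "w \<noteq> 0" using ne by blast
  have "(1 / norm w) *\<^sub>R w \<in> V"
    unfolding scaleR_eq_vec_scale using V w(1) by (rule vec.subspace_scale)
  moreover have "(1 / norm w) *\<^sub>R w \<in> sphere 0 1" using w(2) by simp
  ultimately have "V \<inter> sphere 0 1 \<noteq> {}" by blast
  moreover have "compact (V \<inter> sphere 0 1)"
    using closed_vec_subspace[OF V] by (simp add: closed_Int_compact)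
  ultimately obtain v where v: "v \<in> V" "norm v = 1"
    and max: "\<And>u. u \<in> V \<Longrightarrow> norm u = 1 \<Longrightarrow> Re (h u u) \<le> Re (h v v)"
    using continuous_attains_sup[OF _ _ continuous_on_diagonal, of "V \<inter> sphere 0 1"] by force
  define \<mu> where "\<mu> = Re (h v v)"
  interpret g: hermitian_form "\<lambda>v u. complex_of_real \<mu> * herm_inner v u - h v u"
    by unfold_locales
      (simp_all add: add_left scale_left cnj_swap herm.add_left herm.scale_left herm.cnj_swap
        algebra_simps)
  have "complex_of_real \<mu> * herm_inner v u - h v u = 0" if "u \<in> V" for u
  proof (rule g.semidefinite_null_vector[OF V _ v(1) _ that])
    show "Re (complex_of_real \<mu> * herm_inner v v - h v v) = 0"
      by (simp add: herm_inner_self v \<mu>_def)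
    fix w assume w: "w \<in> V"
    show "0 \<le> Re (complex_of_real \<mu> * herm_inner w w - h w w)"
    proof (cases "w = 0")
      case False
      let ?u = "(1 / norm w) *\<^sub>R w"
      have "?u \<in> V" using w V by (simp add: scaleR_eq_vec_scale vec.subspace_scale)
      then have "Re (h ?u ?u) \<le> \<mu>" unfolding \<mu>_def by (rule max) (use False in simp)
      moreover have "Re (h ?u ?u) = Re (h w w) / (norm w)\<^sup>2"
        unfolding scaleR_eq_vec_scale scale_left scale_right by (simp add: power2_eq_square)
      ultimately show ?thesis
        using False by (simp add: herm_inner_self field_simps)
    qed simp
  qed
  then have "v \<in> form_eigenspace h V \<mu>"
    using v(1) by (simp add: form_eigenspace_def)
  moreover have "v \<noteq> 0" using v(2) by auto
  ultimately show ?thesis using v(1) by blast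
qed

definition eigenbasis :: "(complex^'n) set \<Rightarrow> (complex^'n) set \<Rightarrow> (complex^'n \<Rightarrow> real) \<Rightarrow> bool"
  where "eigenbasis V B m \<longleftrightarrow> finite B \<and> 0 \<notin> B \<and> vec.span B = V \<and>
    (\<forall>b\<in>B. \<forall>b'\<in>B. b \<noteq> b' \<longrightarrow> herm_inner b b' = 0) \<and>
    (\<forall>b\<in>B. b \<in> form_eigenspace h V (m b))"

text \<open>Split off an eigenvector and continue in its orthogonal complement within \<open>V\<close>.\<close>

theorem eigenbasis_exists:
  assumes "vec.subspace V"
  shows "\<exists>B m. eigenbasis V B m"
  using assms
proof (induction "vec.dim V" arbitrary: V rule: less_induct)
  case less
  show ?case
  proof (cases "V = {0}")
    case True
    then show ?thesis by (auto simp: eigenbasis_def intro!: exI[of _ "{}"])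
  next
    case False
    then obtain v \<mu> where v: "v \<in> V" "v \<noteq> 0" "v \<in> form_eigenspace h V \<mu>"
      using eigenvector_exists less.prems by blast
    define V' where "V' = {u \<in> V. herm_inner u v = 0}"
    have V': "vec.subspace V'"
      using less.prems unfolding vec.subspace_def V'_def
      by (auto simp: herm.add_left herm.scale_left)
    have "v \<notin> V'" using v by (simp add: V'_def)
    moreover have "V' \<subseteq> V" by (auto simp: V'_def)
    ultimately have "V' \<subset> V" using v(1) by blast
    moreover have "vec.span V' = V'" "vec.span V = V"
      using V' less.prems by simp_all
    ultimately have "vec.dim V' < vec.dim V" using vec.dim_psubset by metis
    then obtain B m where B: "eigenbasis V' B m" using less.hyps V' by blast
    note B = B[unfolded eigenbasis_def]
    have BV': "B \<subseteq> V'" using B vec.span_superset by metis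
    have split: "\<exists>u' c. u' \<in> V' \<and> u = u' + c *s v" if "u \<in> V" for u
    proof (intro exI conjI)
      let ?c = "herm_inner u v / herm_inner v v"
      let ?u' = "u + (- ?c) *s v"
      have "?u' \<in> V"
        using less.prems that v(1) by (intro vec.subspace_add vec.subspace_scale)
      moreover have "herm_inner ?u' v = 0"
        unfolding herm.add_left herm.scale_left using v(2) by simp
      ultimately show "?u' \<in> V'" unfolding V'_def by blast
      show "u = ?u' + ?c *s v" by (simp add: vec_eq_iff)
    qed
    have swap: "herm_inner v u = 0" if "u \<in> V'" for u
      using that herm.cnj_swap[of u v] by (auto simp: V'_def)
    let ?m = "m(v := \<mu>)"
    have vB: "v \<notin> B" using BV' v by (auto simp: V'_def)
    have "vec.span (insert v B) = V"
    proof
      show "vec.span (insert v B) \<subseteq> V"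
        using BV' v less.prems by (intro vec.span_minimal) (auto simp: V'_def)
      show "V \<subseteq> vec.span (insert v B)"
        using split B by (auto simp: vec.span_breakdown_eq) (metis add_diff_cancel_right')
    qed
    moreover have "b \<in> form_eigenspace h V (m b)" if b: "b \<in> B" for b
    proof -
      have b': "b \<in> V'" "\<And>u. u \<in> V' \<Longrightarrow> h b u = complex_of_real (m b) * herm_inner b u"
        using B b by (auto simp: form_eigenspace_def)
      have "h v b = 0" using v(3) b'(1) swap[of b] by (auto simp: form_eigenspace_def V'_def)
      then have hbv: "h b v = 0" using cnj_swap[of v b] by simp
      have "h b u = complex_of_real (m b) * herm_inner b u" if "u \<in> V" for u
      proof -
        obtain u' c where u: "u' \<in> V'" "u = u' + c *s v"
          using split[OF \<open>u \<in> V\<close>] by blast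
        then show ?thesis
          using b' hbv by (simp add: add_right scale_right herm.add_right herm.scale_right V'_def)
      qed
      then show ?thesis using b'(1) by (simp add: form_eigenspace_def V'_def)
    qed
    moreover have "herm_inner b b' = 0" if "b \<in> insert v B" "b' \<in> insert v B" "b \<noteq> b'" for b b'
      using that B BV' swap by (auto simp: V'_def)
    ultimately have "eigenbasis V (insert v B) ?m"
      using B v vB unfolding eigenbasis_def by auto
    then show ?thesis by blast
  qed
qed

context
  fixes V B m
  assumes basis: "eigenbasis V B m"
begin

lemma eigenbasis_finite: "finite B" and eigenbasis_span: "vec.span B = V"
  and eigenbasis_nonzero: "b \<in> B \<Longrightarrow> b \<noteq> 0"
  and eigenbasis_orthogonal: "b \<in> B \<Longrightarrow> b' \<in> B \<Longrightarrow> b \<noteq> b' \<Longrightarrow> herm_inner b b' = 0"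
  and eigenbasis_eigenvector: "b \<in> B \<Longrightarrow> v \<in> V \<Longrightarrow> h b v = complex_of_real (m b) * herm_inner b v"
  and eigenbasis_subset: "B \<subseteq> V"
  using basis vec.span_superset[of B] by (auto simp: eigenbasis_def form_eigenspace_def)

lemma eigenbasis_coefficient:
  assumes "b \<in> B"
  shows "herm_inner (\<Sum>b\<in>B. c b *s b) b = c b * herm_inner b b"
proof -
  have "herm_inner (\<Sum>b\<in>B. c b *s b) b = (\<Sum>b'\<in>B. if b' = b then c b * herm_inner b b else 0)"
    unfolding herm.sum_left herm.scale_left
    by (intro sum.cong) (use eigenbasis_orthogonal assms in auto)
  then show ?thesis using assms eigenbasis_finite by simp
qed

lemma eigenbasis_independent: "vec.independent B"
  unfolding vec.independent_explicit
proof (intro conjI allI impI ballI)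
  fix c b assume "(\<Sum>b\<in>B. c b *s b) = 0" "b \<in> B"
  then show "c b = 0" using eigenbasis_coefficient[of b c] eigenbasis_nonzero by simp
qed (rule eigenbasis_finite)

lemma eigenbasis_expansion:
  assumes "v \<in> V"
  obtains c where "v = (\<Sum>b\<in>B. c b *s b)"
  using assms eigenbasis_finite unfolding eigenbasis_span[symmetric]
  by (auto simp: vec.span_finite)

text \<open>Eigenvectors for different eigenvalues are orthogonal, so an eigenvector for \<open>\<mu>\<close> has zero
  coefficient at every basis vector whose eigenvalue is not \<open>\<mu>\<close>.\<close>

lemma form_eigenspace_eq_span: "form_eigenspace h V \<mu> = vec.span {b \<in> B. m b = \<mu>}"
proof
  have "vec.subspace V" using eigenbasis_span vec.subspace_span by metis
  then have "vec.subspace (form_eigenspace h V \<mu>)"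
    unfolding vec.subspace_def form_eigenspace_def
    by (auto simp: add_left scale_left herm.add_left herm.scale_left algebra_simps)
  then show "vec.span {b \<in> B. m b = \<mu>} \<subseteq> form_eigenspace h V \<mu>"
    by (rule vec.span_minimal[rotated]) (use basis in \<open>auto simp: eigenbasis_def\<close>)
next
  show "form_eigenspace h V \<mu> \<subseteq> vec.span {b \<in> B. m b = \<mu>}"
  proof
    fix v assume v: "v \<in> form_eigenspace h V \<mu>"
    then have vV: "v \<in> V" by (simp add: form_eigenspace_def)
    then obtain c where c: "v = (\<Sum>b\<in>B. c b *s b)" by (rule eigenbasis_expansion)
    have "c b = 0" if b: "b \<in> B" "m b \<noteq> \<mu>" for b
    proof -
      have "h v b = complex_of_real (m b) * herm_inner v b"
        using eigenbasis_eigenvector[OF b(1) vV] cnj_swap[of b v] herm.cnj_swap[of b v]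
        by (metis complex_cnj_complex_of_real complex_cnj_mult)
      moreover have "h v b = complex_of_real \<mu> * herm_inner v b"
        using v b(1) eigenbasis_subset by (auto simp: form_eigenspace_def)
      ultimately have "herm_inner v b = 0" using b(2) by simp
      then show ?thesis
        using eigenbasis_coefficient[OF b(1), of c] c eigenbasis_nonzero[OF b(1)] by simp
    qed
    then have "c b *s b \<in> vec.span {b \<in> B. m b = \<mu>}" if "b \<in> B" for b
      using that by (cases "m b = \<mu>") (auto intro: vec.span_scale vec.span_base vec.span_zero)
    then show "v \<in> vec.span {b \<in> B. m b = \<mu>}" unfolding c by (intro vec.span_sum) auto
  qed
qed

lemma eigenvalue_count_eq_card: "eigenvalue_count h V A = card {b \<in> B. m b \<in> A}"
proof -
  have dim: "vec.dim (form_eigenspace h V \<mu>) = card {b \<in> B. m b = \<mu>}" for \<mu>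
    unfolding form_eigenspace_eq_span
    by (rule vec.dim_span_eq_card_independent)
      (rule vec.independent_mono[OF eigenbasis_independent], auto)
  have "form_eigenspace h V \<mu> \<noteq> {0} \<longleftrightarrow> \<mu> \<in> m ` B" for \<mu>
  proof -
    have "vec.span {b \<in> B. m b = \<mu>} = {0} \<longleftrightarrow> {b \<in> B. m b = \<mu>} = {}"
    proof
      assume "vec.span {b \<in> B. m b = \<mu>} = {0}"
      then have "{b \<in> B. m b = \<mu>} \<subseteq> {0}" using vec.span_superset by metis
      then show "{b \<in> B. m b = \<mu>} = {}" using eigenbasis_nonzero by auto
    qed (simp only: vec.span_empty)
    then show ?thesis unfolding form_eigenspace_eq_span by auto
  qed
  then have "{\<mu> \<in> A. form_eigenspace h V \<mu> \<noteq> {0}} = m ` {b \<in> B. m b \<in> A}" by auto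
  moreover have "card {b \<in> B. m b \<in> A} =
      (\<Sum>\<mu>\<in>m ` {b \<in> B. m b \<in> A}. card {b \<in> {b \<in> B. m b \<in> A}. m b = \<mu>})"
    using sum.image_gen[of "{b \<in> B. m b \<in> A}" "\<lambda>_. 1::nat" m] eigenbasis_finite by simp
  moreover have "{b \<in> {b \<in> B. m b \<in> A}. m b = \<mu>} = {b \<in> B. m b = \<mu>}"
    if "\<mu> \<in> m ` {b \<in> B. m b \<in> A}" for \<mu>
    using that by auto
  ultimately show ?thesis
    unfolding eigenvalue_count_def dim by (simp cong: sum.cong)
qed

lemma form_on_eigenbasis_expansion:
  "Re (h (\<Sum>b\<in>B. c b *s b) (\<Sum>b\<in>B. c b *s b)) = (\<Sum>b\<in>B. m b * (cmod (c b) * norm b)\<^sup>2)"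
proof -
  have "h (\<Sum>b\<in>B. c b *s b) (\<Sum>b\<in>B. c b *s b) =
      (\<Sum>b\<in>B. c b * (complex_of_real (m b) * herm_inner b (\<Sum>b\<in>B. c b *s b)))"
    unfolding sum_left scale_left
  proof (intro sum.cong refl)
    fix b assume b: "b \<in> B"
    have "(\<Sum>b\<in>B. c b *s b) \<in> V"
      unfolding eigenbasis_span[symmetric]
      by (intro vec.span_sum vec.span_scale vec.span_base)
    then show "c b * h b (\<Sum>b\<in>B. c b *s b) =
        c b * (complex_of_real (m b) * herm_inner b (\<Sum>b\<in>B. c b *s b))"
      using eigenbasis_eigenvector[OF b] by simp
  qed
  also have "\<dots> = (\<Sum>b\<in>B. complex_of_real (m b * (cmod (c b) * norm b)\<^sup>2))"
  proof (intro sum.cong refl)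
    fix b assume b: "b \<in> B"
    have "herm_inner b (\<Sum>b\<in>B. c b *s b) = cnj (c b) * complex_of_real ((norm b)\<^sup>2)"
      using herm.cnj_swap[of "\<Sum>b\<in>B. c b *s b" b] eigenbasis_coefficient[OF b, of c]
      by (simp add: herm_inner_self)
    then show "c b * (complex_of_real (m b) * herm_inner b (\<Sum>b\<in>B. c b *s b)) =
        complex_of_real (m b * (cmod (c b) * norm b)\<^sup>2)"
      using complex_norm_square[of "c b"] by (simp add: power_mult_distrib algebra_simps)
  qed
  finally show ?thesis by simp
qed

text \<open>The sign \<open>s\<close> treats positive (\<open>s = 1\<close>) and negative (\<open>s = -1\<close>) subspaces at once. A definite
  subspace meets the span of the basis vectors of the other sign, or of eigenvalue zero, only in
  \<open>0\<close>, and so the dimensions add up to at most that of \<open>V\<close>.\<close>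

lemma definite_subspace_dim_le:
  fixes s :: real
  assumes W: "vec.subspace W" "W \<subseteq> V"
    and definite: "\<And>w. w \<in> W \<Longrightarrow> w \<noteq> 0 \<Longrightarrow> 0 < s * Re (h w w)"
  shows "vec.dim W \<le> card {b \<in> B. 0 < s * m b}"
proof -
  let ?N = "{b \<in> B. \<not> 0 < s * m b}"
  have "W \<inter> vec.span ?N = {0}"
  proof -
    have "w = 0" if w: "w \<in> W" "w \<in> vec.span ?N" for w
    proof (rule ccontr)
      assume "w \<noteq> 0"
      have "finite ?N" using eigenbasis_finite by simp
      then obtain d where d: "w = (\<Sum>b\<in>?N. d b *s b)"
        using w(2) by (auto simp: vec.span_finite)
      define c where "c b = (if b \<in> ?N then d b else 0)" for b
      have "w = (\<Sum>b\<in>B. c b *s b)"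
        unfolding d c_def
        by (rule sum.mono_neutral_cong_left) (use eigenbasis_finite in auto)
      then have "s * Re (h w w) = (\<Sum>b\<in>B. s * m b * (cmod (c b) * norm b)\<^sup>2)"
        using form_on_eigenbasis_expansion[of c] by (simp add: sum_distrib_left mult.assoc)
      also have "\<dots> \<le> 0"
        by (rule sum_nonpos) (auto simp: c_def mult_nonpos_nonneg)
      finally show False using definite[OF w(1) \<open>w \<noteq> 0\<close>] by simp
    qed
    moreover have "0 \<in> W" using W(1) by (rule vec.subspace_0)
    ultimately show ?thesis using vec.span_zero by blast
  qed
  then have "vec.dim {x + y |x y. x \<in> W \<and> y \<in> vec.span ?N} = vec.dim W + vec.dim (vec.span ?N)"
    using vec.dim_sums_Int[OF W(1) vec.subspace_span, of ?N] by simp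
  moreover have "vec.dim {x + y |x y. x \<in> W \<and> y \<in> vec.span ?N} \<le> vec.dim V"
  proof (rule vec.dim_subset)
    have "vec.span ?N \<subseteq> V" unfolding eigenbasis_span[symmetric] by (rule vec.span_mono) auto
    moreover have "vec.subspace V" using eigenbasis_span vec.subspace_span by metis
    ultimately show "{x + y |x y. x \<in> W \<and> y \<in> vec.span ?N} \<subseteq> V"
      using W(2) by (auto intro: vec.subspace_add)
  qed
  moreover have "vec.dim (vec.span ?N) = card ?N"
    by (rule vec.dim_span_eq_card_independent)
      (rule vec.independent_mono[OF eigenbasis_independent], auto)
  moreover have "vec.dim V = card B"
    using vec.dim_span_eq_card_independent[OF eigenbasis_independent] eigenbasis_span by simp
  moreover have "card B = card {b \<in> B. 0 < s * m b} + card ?N"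
  proof -
    have "card ({b \<in> B. 0 < s * m b} \<union> ?N) = card {b \<in> B. 0 < s * m b} + card ?N"
      by (rule card_Un_disjoint) (use eigenbasis_finite in auto)
    moreover have "{b \<in> B. 0 < s * m b} \<union> ?N = B" by blast
    ultimately show ?thesis by simp
  qed
  ultimately show ?thesis by linarith
qed

end

text \<open>Sylvester's law: the two lower bounds from \<open>definite_subspace_dim_le\<close> already exhaust the
  dimension of \<open>V\<close>, so both are attained and no room is left for the eigenvalue \<open>0\<close>.\<close>

theorem inertia:
  assumes V: "vec.subspace V"
    and P: "vec.subspace P" "P \<subseteq> V" "\<And>w. w \<in> P \<Longrightarrow> w \<noteq> 0 \<Longrightarrow> 0 < Re (h w w)"
    and N: "vec.subspace N" "N \<subseteq> V" "\<And>w. w \<in> N \<Longrightarrow> w \<noteq> 0 \<Longrightarrow> Re (h w w) < 0"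
    and dim: "vec.dim P + vec.dim N = vec.dim V"
  shows "eigenvalue_count h V {0<..} = vec.dim P"
    and "eigenvalue_count h V {..<0} = vec.dim N"
    and "v \<in> V \<Longrightarrow> (\<And>u. u \<in> V \<Longrightarrow> h v u = 0) \<Longrightarrow> v = 0"
proof -
  obtain B m where B: "eigenbasis V B m" using eigenbasis_exists V by blast
  let ?p = "{b \<in> B. 0 < m b}" and ?n = "{b \<in> B. m b < 0}" and ?z = "{b \<in> B. m b = 0}"
  have "vec.dim P \<le> card ?p"
    using definite_subspace_dim_le[OF B P(1,2), of 1] P(3) by simp
  moreover have "vec.dim N \<le> card ?n"
    using definite_subspace_dim_le[OF B N(1,2), of "-1"] N(3) by simp
  moreover have "card ?p + card ?n + card ?z = vec.dim V"
  proof -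
    note fin = eigenbasis_finite[OF B]
    have "card (?p \<union> ?n \<union> ?z) = card (?p \<union> ?n) + card ?z"
      by (rule card_Un_disjoint) (use fin in auto)
    moreover have "card (?p \<union> ?n) = card ?p + card ?n"
      by (rule card_Un_disjoint) (use fin in auto)
    moreover have "?p \<union> ?n \<union> ?z = B" by auto
    moreover have "vec.dim V = card B"
      using vec.dim_span_eq_card_independent[OF eigenbasis_independent[OF B]]
        eigenbasis_span[OF B] by simp
    ultimately show ?thesis by simp
  qed
  ultimately have card: "card ?p = vec.dim P" "card ?n = vec.dim N" "card ?z = 0"
    using dim by linarith+
  show "eigenvalue_count h V {0<..} = vec.dim P" "eigenvalue_count h V {..<0} = vec.dim N"
    unfolding eigenvalue_count_eq_card[OF B] using card by simp_all
  assume "v \<in> V" "\<And>u. u \<in> V \<Longrightarrow> h v u = 0"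
  then have "v \<in> form_eigenspace h V 0" by (simp add: form_eigenspace_def)
  moreover have "?z = {}" using card(3) eigenbasis_finite[OF B] by auto
  ultimately show "v = 0" using form_eigenspace_eq_span[OF B, of 0] by simp
qed

end

section \<open>Graphs with a Levi form of split sign\<close>

text \<open>Since \<open>r\<close> is a graph function in the direction of the \<open>k\<close>-th coordinate, the tangent space is
  parametrized by the remaining coordinates. Those in \<open>J\<close> give a negative subspace, the
  others a positive one.\<close>

lemma levi_signature_of_graph:
  fixes r :: "complex^'n \<Rightarrow> real"
  assumes poly: "real_polynomial_function r" and U: "open U"
    and shift: "\<And>x s. r (x + s *\<^sub>R axis k c) = r x + s"
    and k: "k \<notin> J" and card_J: "card J = l" "real l \<le> (real CARD('n) - 1) / 2"
    and hermitian: "\<And>p. p \<in> U \<Longrightarrow> hermitian_form (levi_form r p)"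
    and neg: "\<And>p v. p \<in> U \<Longrightarrow> \<forall>j. j \<notin> J \<and> j \<noteq> k \<longrightarrow> v $ j = 0 \<Longrightarrow> \<exists>j\<in>J. v $ j \<noteq> 0 \<Longrightarrow>
      Re (levi_form r p v v) < 0"
    and pos: "\<And>p v. p \<in> U \<Longrightarrow> \<forall>j\<in>J. v $ j = 0 \<Longrightarrow> \<exists>j. j \<notin> J \<and> j \<noteq> k \<and> v $ j \<noteq> 0 \<Longrightarrow>
      0 < Re (levi_form r p v v)"
  defines "M \<equiv> {x. r x = 0} \<inter> U"
  shows "real_analytic_hypersurface M \<and> levi_nondegenerate M \<and> has_signature M l"
proof (intro conjI)
  have D: "(r has_derivative frechet_derivative r (at p)) (at p)" for p
    using differentiable_at_real_polynomial_function[OF poly]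
    by (simp add: frechet_derivative_works)
  have "frechet_derivative r (at p) \<noteq> (\<lambda>v. 0)" for p
  proof
    assume "frechet_derivative r (at p) = (\<lambda>v. 0)"
    then have D0: "(r has_derivative (\<lambda>v. 0)) (at (p + 0 *\<^sub>R axis k c))" using D[of p] by simp
    have line: "((\<lambda>s. p + s *\<^sub>R axis k c) has_derivative (\<lambda>s. s *\<^sub>R axis k c)) (at 0)"
      by (auto intro!: derivative_eq_intros)
    have "((\<lambda>s. r p + s) has_derivative (\<lambda>s. 0)) (at 0)"
      using diff_chain_at[OF line D0] by (simp add: o_def shift)
    moreover have "((\<lambda>s. r p + s) has_derivative (\<lambda>s. s)) (at 0)"
      by (auto intro!: derivative_eq_intros)
    ultimately have "(\<lambda>s::real. 0) = (\<lambda>s::real. s)" by (rule has_derivative_unique)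
    then show False by (meson zero_neq_one)
  qed
  then have defining: "local_defining_function M U r"
    using real_analytic_on_polynomial[OF poly U]
    by (auto simp: local_defining_function_def M_def)
  then show "real_analytic_hypersurface M"
    unfolding real_analytic_hypersurface_def by (auto simp: M_def)
  have type: "(\<forall>v\<in>T10 M p. (\<forall>u\<in>T10 M p. levi_form r p v u = 0) \<longrightarrow> v = 0) \<and>
      eigenvalue_count (levi_form r p) (T10 M p) {..<0} = card J \<and>
      eigenvalue_count (levi_form r p) (T10 M p) {0<..} = CARD('n) - 1 - card J"
    if p: "p \<in> M" for p
  proof -
    have "p \<in> U" "r p = 0" using p by (auto simp: M_def)
    interpret hermitian_form "levi_form r p" using hermitian \<open>p \<in> U\<close> .
    obtain a where T10: "T10 M p = graph_subspace k a"
      unfolding M_def using T10_level_set[OF D \<open>r p = 0\<close> \<open>p \<in> U\<close> U shift] by blast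
    let ?S = "\<lambda>J. {v \<in> graph_subspace k a. \<forall>j. j \<notin> J \<and> j \<noteq> k \<longrightarrow> v $ j = 0}"
    define K where "K = UNIV - {k} - J"
    have J_subset: "J \<subseteq> UNIV - {k}" using k by auto
    have dims: "vec.dim (?S J) = card J" "vec.dim (?S K) = card K"
        "vec.dim (?S (UNIV - {k})) = card (UNIV - {k})"
      by (rule dim_graph_subspace_supported, use k in \<open>simp add: K_def\<close>)+
    moreover have "card (UNIV - {k}) = CARD('n) - 1" by (simp add: card_Diff_singleton)
    moreover have V: "?S (UNIV - {k}) = graph_subspace k a" by auto
    moreover have card_K: "card K = CARD('n) - 1 - card J"
      using J_subset by (simp add: K_def card_Diff_subset card_Diff_singleton)
    moreover have "card J \<le> card (UNIV - {k})" by (rule card_mono) (use J_subset in auto)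
    ultimately have dim: "vec.dim (?S K) + vec.dim (?S J) = vec.dim (graph_subspace k a)"
      by simp
    have nonzero: "\<exists>j. j \<noteq> k \<and> v $ j \<noteq> 0" if "v \<in> graph_subspace k a" "v \<noteq> 0" for v
    proof (rule ccontr)
      assume *: "\<not> (\<exists>j. j \<noteq> k \<and> v $ j \<noteq> 0)"
      have "v $ k = (\<Sum>j\<in>UNIV - {k}. a j * v $ j)"
        using that(1) by (simp add: graph_subspace_def)
      also have "\<dots> = 0" using * by (intro sum.neutral) auto
      finally have "v = 0" using * by (auto simp: vec_eq_iff)
      then show False using that(2) by simp
    qed
    have posK: "0 < Re (levi_form r p v v)" if "v \<in> ?S K" "v \<noteq> 0" for v
      using that nonzero[of v] k by (intro pos \<open>p \<in> U\<close>) (auto simp: K_def)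
    have negJ: "Re (levi_form r p v v) < 0" if "v \<in> ?S J" "v \<noteq> 0" for v
      using that nonzero[of v] k by (intro neg \<open>p \<in> U\<close>) auto
    note I = inertia[OF subspace_graph_subspace subspace_graph_subspace_supported _ posK
        subspace_graph_subspace_supported _ negJ dim]
    show ?thesis
      unfolding T10 using I dims card_K by auto
  qed
  show "levi_nondegenerate M"
    unfolding levi_nondegenerate_def
  proof
    fix p assume p: "p \<in> M"
    then have "p \<in> U" by (simp add: M_def)
    then show "\<exists>U \<rho>. p \<in> U \<and> local_defining_function M U \<rho> \<and>
        (\<forall>v\<in>T10 M p. (\<forall>u\<in>T10 M p. levi_form \<rho> p v u = 0) \<longrightarrow> v = 0)"
      using defining type[OF p] by blast
  qed
  show "has_signature M l"
    unfolding has_signature_def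
  proof (intro conjI ballI card_J(2))
    fix p assume p: "p \<in> M"
    then have "p \<in> U" by (simp add: M_def)
    then show "\<exists>U \<rho>. p \<in> U \<and> local_defining_function M U \<rho> \<and>
        (\<exists>\<sigma>\<in>{\<rho>, \<lambda>x. - \<rho> x}.
           eigenvalue_count (levi_form \<sigma> p) (T10 M p) {..<0} = l \<and>
           eigenvalue_count (levi_form \<sigma> p) (T10 M p) {0<..} = CARD('n) - 1 - l)"
      using defining type[OF p] unfolding card_J(1) by blast
  qed
qed

text \<open>The set is the continuous image of the convex cylinder \<open>U\<close> under the projection along \<open>e\<close>.\<close>

lemma connected_graph:
  fixes r :: "'a::real_normed_vector \<Rightarrow> real"
  assumes "continuous_on U r" "convex U"
    and shift: "\<And>x s. r (x + s *\<^sub>R e) = r x + s"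
    and cylinder: "\<And>x s. x \<in> U \<Longrightarrow> x + s *\<^sub>R e \<in> U"
  shows "connected ({x. r x = 0} \<inter> U)"
proof -
  let ?g = "\<lambda>x. x + (- r x) *\<^sub>R e"
  have "connected (?g ` U)"
    using assms(1,2) by (intro connected_continuous_image continuous_intros convex_connected)
  moreover have "?g ` U = {x. r x = 0} \<inter> U"
  proof
    show "?g ` U \<subseteq> {x. r x = 0} \<inter> U"
    proof clarify
      fix x assume "x \<in> U"
      then show "?g x \<in> {x. r x = 0} \<inter> U"
        using cylinder[of x "- r x"] shift[of x "- r x"] by simp
    qed
    show "{x. r x = 0} \<inter> U \<subseteq> ?g ` U" by force
  qed
  ultimately show ?thesis by simp
qed

section \<open>Wirtinger calculus and the two Levi forms\<close>

lemma wirtinger_eqs: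
  assumes "(g has_derivative D) (at x)"
  shows "wirtinger j g x = (D (axis j 1) - \<i> * D (axis j \<i>)) / 2"
    and "wirtinger_bar j g x = (D (axis j 1) + \<i> * D (axis j \<i>)) / 2"
  using frechet_derivative_at[OF assms] by (simp_all add: wirtinger_def wirtinger_bar_def)

lemma has_derivative_coord: "((\<lambda>x. x $ k) has_derivative (\<lambda>v. v $ k)) F"
  by (rule bounded_linear_imp_has_derivative[OF bounded_linear_vec_nth])

lemma has_derivative_cnj_coord:
  "((\<lambda>x :: complex^'n. cnj (x $ k)) has_derivative (\<lambda>v. cnj (v $ k))) F"
  by (rule bounded_linear_imp_has_derivative)
    (rule bounded_linear_compose[OF bounded_linear_cnj bounded_linear_vec_nth])

lemma differentiable_coord [simp]:
  "(\<lambda>x :: complex^'n. x $ k) differentiable F" "(\<lambda>x :: complex^'n. cnj (x $ k)) differentiable F"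
  using has_derivative_coord has_derivative_cnj_coord by (blast intro: differentiableI)+

lemma wirtinger_coord:
  "wirtinger j (\<lambda>x. x $ k) p = (if j = k then 1 else 0)"
  "wirtinger j (\<lambda>x. cnj (x $ k)) p = 0"
  "wirtinger_bar j (\<lambda>x. x $ k) p = 0"
  "wirtinger_bar j (\<lambda>x. cnj (x $ k)) p = (if j = k then 1 else 0)"
  "wirtinger j (\<lambda>x. a) p = 0"
  "wirtinger_bar j (\<lambda>x. a) p = 0"
  unfolding wirtinger_eqs[OF has_derivative_coord] wirtinger_eqs[OF has_derivative_cnj_coord]
    wirtinger_eqs[OF has_derivative_const]
  by (simp_all add: axis_def)

lemma wirtinger_arith:
  assumes "f differentiable (at p)" "g differentiable (at p)"
  shows "wirtinger j (\<lambda>x. f x + g x) p = wirtinger j f p + wirtinger j g p"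
    "wirtinger_bar j (\<lambda>x. f x + g x) p = wirtinger_bar j f p + wirtinger_bar j g p"
    "wirtinger j (\<lambda>x. f x - g x) p = wirtinger j f p - wirtinger j g p"
    "wirtinger_bar j (\<lambda>x. f x - g x) p = wirtinger_bar j f p - wirtinger_bar j g p"
    "wirtinger j (\<lambda>x. f x * g x) p = wirtinger j f p * g p + f p * wirtinger j g p"
    "wirtinger_bar j (\<lambda>x. f x * g x) p = wirtinger_bar j f p * g p + f p * wirtinger_bar j g p"
proof -
  note f = assms(1)[unfolded frechet_derivative_works]
    and g = assms(2)[unfolded frechet_derivative_works]
  show "wirtinger j (\<lambda>x. f x + g x) p = wirtinger j f p + wirtinger j g p"
    "wirtinger_bar j (\<lambda>x. f x + g x) p = wirtinger_bar j f p + wirtinger_bar j g p"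
    unfolding wirtinger_eqs[OF has_derivative_add[OF f g]]
    unfolding wirtinger_def wirtinger_bar_def by (simp_all add: field_simps)
  show "wirtinger j (\<lambda>x. f x - g x) p = wirtinger j f p - wirtinger j g p"
    "wirtinger_bar j (\<lambda>x. f x - g x) p = wirtinger_bar j f p - wirtinger_bar j g p"
    unfolding wirtinger_eqs[OF has_derivative_diff[OF f g]]
    unfolding wirtinger_def wirtinger_bar_def by (simp_all add: field_simps)
  show "wirtinger j (\<lambda>x. f x * g x) p = wirtinger j f p * g p + f p * wirtinger j g p"
    "wirtinger_bar j (\<lambda>x. f x * g x) p = wirtinger_bar j f p * g p + f p * wirtinger_bar j g p"
    unfolding wirtinger_eqs[OF has_derivative_mult[OF f g]]
    unfolding wirtinger_def wirtinger_bar_def by (simp_all add: field_simps)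
qed

lemma wirtinger_uminus:
  assumes "f differentiable (at p)"
  shows "wirtinger j (\<lambda>x. - f x) p = - wirtinger j f p"
    "wirtinger_bar j (\<lambda>x. - f x) p = - wirtinger_bar j f p"
  using wirtinger_arith(3,4)[of "\<lambda>_. 0" p f j] assms by (simp_all add: wirtinger_coord)

lemma exhaust_5:
  fixes x :: 5
  shows "x = 1 \<or> x = 2 \<or> x = 3 \<or> x = 4 \<or> x = 5"
proof (induct x)
  case (of_int z)
  then have "z = 0 \<or> z = 1 \<or> z = 2 \<or> z = 3 \<or> z = 4" by fastforce
  then show ?case by auto
qed

lemma UNIV_5: "UNIV = {1, 2, 3, 4, 5::5}"
  using exhaust_5 by auto

lemma sum_5: "sum f (UNIV::5 set) = f 1 + f 2 + f 3 + f 4 + f 5"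
  unfolding UNIV_5 by (simp add: ac_simps)

text \<open>The sign is chosen so that the form has fewer negative than positive eigenvalues.\<close>

lemma levi_form_rho1:
  "levi_form (\<lambda>x. - rho1 x) p v u =
    - (v $ 1 * cnj (u $ 1)) + v $ 2 * cnj (u $ 2) + v $ 3 * cnj (u $ 3)"
proof -
  \<comment> \<open>A name keeps the simplifier from pulling the division out of the product.\<close>
  define c where "c = \<i> / 2"
  have rho: "(\<lambda>x. complex_of_real (- rho1 x)) = (\<lambda>x. c * (x $ 4 - cnj (x $ 4))
      - x $ 1 * cnj (x $ 1) + x $ 2 * cnj (x $ 2) + x $ 3 * cnj (x $ 3))"
    by (rule ext) (unfold rho1_def c_def cmod_power2, simp add: complex_eq_iff power2_eq_square algebra_simps)
  have bar: "wirtinger_bar 1 (\<lambda>x. complex_of_real (- rho1 x)) = (\<lambda>x. - x $ 1)"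
    "wirtinger_bar 2 (\<lambda>x. complex_of_real (- rho1 x)) = (\<lambda>x. x $ 2)"
    "wirtinger_bar 3 (\<lambda>x. complex_of_real (- rho1 x)) = (\<lambda>x. x $ 3)"
    "wirtinger_bar 4 (\<lambda>x. complex_of_real (- rho1 x)) = (\<lambda>x. - c)"
    unfolding rho by (rule ext, simp add: wirtinger_coord wirtinger_arith wirtinger_uminus)+
  show ?thesis
    unfolding levi_form_def sum_4 bar by (simp add: wirtinger_coord wirtinger_arith wirtinger_uminus)
qed

lemma levi_form_rho2:
  "levi_form (\<lambda>x. - rho2 x) p v u =
    - (1 + 2 * p $ 2 * cnj (p $ 2)) * v $ 1 * cnj (u $ 1)
    - 2 * p $ 1 * cnj (p $ 2) * v $ 2 * cnj (u $ 1)
    - 2 * cnj (p $ 1) * p $ 2 * v $ 1 * cnj (u $ 2)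
    + (1 - 2 * p $ 1 * cnj (p $ 1)) * v $ 2 * cnj (u $ 2)
    + v $ 3 * cnj (u $ 3) + v $ 4 * cnj (u $ 4)"
proof -
  \<comment> \<open>A name keeps the simplifier from pulling the division out of the product.\<close>
  define c where "c = \<i> / 2"
  have rho: "(\<lambda>x. complex_of_real (- rho2 x)) = (\<lambda>x. c * (x $ 5 - cnj (x $ 5))
      - x $ 1 * cnj (x $ 1) + x $ 2 * cnj (x $ 2) + x $ 3 * cnj (x $ 3) + x $ 4 * cnj (x $ 4)
      - 2 * (x $ 1 * cnj (x $ 1)) * (x $ 2 * cnj (x $ 2)))"
    by (rule ext) (unfold rho2_def c_def cmod_power2, simp add: complex_eq_iff power2_eq_square algebra_simps)
  have bar: "wirtinger_bar 1 (\<lambda>x. complex_of_real (- rho2 x)) =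
      (\<lambda>x. - x $ 1 - 2 * x $ 1 * (x $ 2 * cnj (x $ 2)))"
    "wirtinger_bar 2 (\<lambda>x. complex_of_real (- rho2 x)) =
      (\<lambda>x. x $ 2 - 2 * (x $ 1 * cnj (x $ 1)) * x $ 2)"
    "wirtinger_bar 3 (\<lambda>x. complex_of_real (- rho2 x)) = (\<lambda>x. x $ 3)"
    "wirtinger_bar 4 (\<lambda>x. complex_of_real (- rho2 x)) = (\<lambda>x. x $ 4)"
    "wirtinger_bar 5 (\<lambda>x. complex_of_real (- rho2 x)) = (\<lambda>x. - c)"
    unfolding rho by (rule ext, simp add: wirtinger_coord wirtinger_arith wirtinger_uminus)+
  show ?thesis
    unfolding levi_form_def sum_5 bar
    by (simp add: wirtinger_coord wirtinger_arith wirtinger_uminus algebra_simps)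
qed

section \<open>The hypersurfaces and their signature\<close>

text \<open>Both sets are convex and invariant under translation in the direction of the imaginary part of
  the last coordinate. Hence they cut connected pieces out of \<open>M1\<close> and \<open>M2\<close>. The
  bounds of the first one give \<open>\<bar>z\<^sub>1\<bar> < \<bar>z\<^sub>2 + 1\<bar>\<close>, which says that \<open>Fmap 1\<close> takes values in the
  second one.\<close>

definition cylinder1 :: "(complex^4) set" where
  "cylinder1 = {x. cmod (x $ 1) < 1 / 2 \<and> cmod (x $ 2) < 1 / 2}"

definition cylinder2 :: "(complex^5) set" where
  "cylinder2 = {X. cmod (X $ 1) < 1 / sqrt 2}"

lemma open_cylinder1: "open cylinder1"
  unfolding cylinder1_def by (intro open_Collect_conj open_Collect_less continuous_intros)

lemma open_cylinder2: "open cylinder2"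
  unfolding cylinder2_def by (intro open_Collect_less continuous_intros)

lemma bounded_linear_Re_Im_coord:
  "bounded_linear (\<lambda>x :: complex^'n. Re (x $ k))" "bounded_linear (\<lambda>x :: complex^'n. Im (x $ k))"
  by (rule bounded_linear_compose[OF bounded_linear_Re bounded_linear_vec_nth],
      rule bounded_linear_compose[OF bounded_linear_Im bounded_linear_vec_nth])

lemma real_polynomial_Re_Im_coord:
  "real_polynomial_function (\<lambda>x :: complex^'n. Re (x $ k))"
  "real_polynomial_function (\<lambda>x :: complex^'n. Im (x $ k))"
  by (intro real_polynomial_function.intros(1) bounded_linear_Re_Im_coord)+

lemmas real_polynomial_intros = real_polynomial_Re_Im_coord real_polynomial_function.intros(2-4)
  real_polynomial_function_minus
  real_polynomial_function_diff real_polynomial_function_power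

lemma real_polynomial_rho1: "real_polynomial_function (\<lambda>x. - rho1 x)"
  unfolding rho1_def cmod_power2 by (intro real_polynomial_intros)

lemma real_polynomial_rho2: "real_polynomial_function (\<lambda>x. - rho2 x)"
  unfolding rho2_def cmod_power2 by (intro real_polynomial_intros)

lemma rho1_shift: "- rho1 (x + s *\<^sub>R axis 4 (- \<i>)) = - rho1 x + s"
  by (simp add: rho1_def axis_def)

lemma rho2_shift: "- rho2 (x + s *\<^sub>R axis 5 (- \<i>)) = - rho2 x + s"
  by (simp add: rho2_def axis_def)

lemma M1_signature:
  assumes "open U"
  shows "real_analytic_hypersurface (M1 \<inter> U)" "levi_nondegenerate (M1 \<inter> U)"
    "has_signature (M1 \<inter> U) 1"
proof -
  have hermitian: "hermitian_form (levi_form (\<lambda>x. - rho1 x) p)" for p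
    by unfold_locales (simp_all add: levi_form_rho1 algebra_simps)
  have form: "Re (levi_form (\<lambda>x. - rho1 x) p v v) =
      - (cmod (v $ 1))\<^sup>2 + (cmod (v $ 2))\<^sup>2 + (cmod (v $ 3))\<^sup>2" for p v
    unfolding levi_form_rho1 cmod_power2 by (simp add: power2_eq_square)
  have M: "M1 \<inter> U = {x. - rho1 x = 0} \<inter> U" by (auto simp: M1_def)
  have neg: "Re (levi_form (\<lambda>x. - rho1 x) p v v) < 0"
    if "\<forall>j. j \<notin> {1} \<and> j \<noteq> 4 \<longrightarrow> v $ j = 0" "\<exists>j\<in>{1}. v $ j \<noteq> 0" for p v
    using that unfolding form by simp
  have pos: "0 < Re (levi_form (\<lambda>x. - rho1 x) p v v)"
    if v: "\<forall>j\<in>{1}. v $ j = 0" "\<exists>j. j \<notin> {1} \<and> j \<noteq> 4 \<and> v $ j \<noteq> 0" for p v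
  proof -
    have "v $ 2 \<noteq> 0 \<or> v $ 3 \<noteq> 0" using v(2) exhaust_4 by auto
    then show ?thesis using v(1) unfolding form by (auto intro: add_pos_nonneg add_nonneg_pos)
  qed
  have "real_analytic_hypersurface (M1 \<inter> U) \<and> levi_nondegenerate (M1 \<inter> U) \<and>
      has_signature (M1 \<inter> U) 1"
    unfolding M
    by (rule levi_signature_of_graph[where J = "{1}" and k = 4], rule real_polynomial_rho1,
        rule assms, rule rho1_shift, simp, simp, simp, rule hermitian, (rule neg; assumption),
        (rule pos; assumption))
  then show "real_analytic_hypersurface (M1 \<inter> U)" "levi_nondegenerate (M1 \<inter> U)"
    "has_signature (M1 \<inter> U) 1"
    by blast+
qed

text \<open>On the plane of the coordinates \<open>1, 2\<close> the Levi form has the diagonal entries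
  \<open>-(1 + 2\<bar>Z\<^sub>2\<bar>\<^sup>2)\<close> and \<open>1 - 2\<bar>Z\<^sub>1\<bar>\<^sup>2\<close>. The cylinder is where the second one is
  positive; the off-diagonal entries do not affect the two coordinate subspaces.\<close>

lemma M2_signature:
  shows "real_analytic_hypersurface (M2 \<inter> cylinder2)" "levi_nondegenerate (M2 \<inter> cylinder2)"
    "has_signature (M2 \<inter> cylinder2) 1"
proof -
  have hermitian: "hermitian_form (levi_form (\<lambda>x. - rho2 x) p)" for p
    by unfold_locales (simp_all add: levi_form_rho2 algebra_simps)
  have M: "M2 \<inter> cylinder2 = {x. - rho2 x = 0} \<inter> cylinder2" by (auto simp: M2_def)
  have neg: "Re (levi_form (\<lambda>x. - rho2 x) p v v) < 0"
    if v: "\<forall>j. j \<notin> {1} \<and> j \<noteq> 5 \<longrightarrow> v $ j = 0" "\<exists>j\<in>{1}. v $ j \<noteq> 0" for p v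
  proof -
    have "v $ 2 = 0" "v $ 3 = 0" "v $ 4 = 0" using v(1) by simp_all
    then have "Re (levi_form (\<lambda>x. - rho2 x) p v v) =
        - ((1 + 2 * (cmod (p $ 2))\<^sup>2) * (cmod (v $ 1))\<^sup>2)"
      unfolding levi_form_rho2 cmod_power2 by (simp add: power2_eq_square algebra_simps)
    moreover have "0 < (1 + 2 * (cmod (p $ 2))\<^sup>2) * (cmod (v $ 1))\<^sup>2"
      using v(2) by (intro mult_pos_pos add_pos_nonneg) auto
    ultimately show ?thesis by linarith
  qed
  have pos: "0 < Re (levi_form (\<lambda>x. - rho2 x) p v v)"
    if p: "p \<in> cylinder2" and v: "\<forall>j\<in>{1}. v $ j = 0" "\<exists>j. j \<notin> {1} \<and> j \<noteq> 5 \<and> v $ j \<noteq> 0" for p v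
  proof -
    have form: "Re (levi_form (\<lambda>x. - rho2 x) p v v) =
        (1 - 2 * (cmod (p $ 1))\<^sup>2) * (cmod (v $ 2))\<^sup>2 + (cmod (v $ 3))\<^sup>2 + (cmod (v $ 4))\<^sup>2"
      using v(1) unfolding levi_form_rho2 cmod_power2
      by (simp add: power2_eq_square algebra_simps)
    have "(cmod (p $ 1))\<^sup>2 < (1 / sqrt 2)\<^sup>2"
      using p by (intro power_strict_mono) (auto simp: cylinder2_def)
    then have "0 < 1 - 2 * (cmod (p $ 1))\<^sup>2" by (simp add: power_divide)
    moreover have "v $ 2 \<noteq> 0 \<or> v $ 3 \<noteq> 0 \<or> v $ 4 \<noteq> 0" using v(2) exhaust_5 by auto
    moreover have "0 \<le> (1 - 2 * (cmod (p $ 1))\<^sup>2) * (cmod (v $ 2))\<^sup>2"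
      "v $ 2 \<noteq> 0 \<Longrightarrow> 0 < (1 - 2 * (cmod (p $ 1))\<^sup>2) * (cmod (v $ 2))\<^sup>2"
      using calculation(1) by simp_all
    moreover have "0 \<le> (cmod (v $ 3))\<^sup>2" "v $ 3 \<noteq> 0 \<Longrightarrow> 0 < (cmod (v $ 3))\<^sup>2"
      "0 \<le> (cmod (v $ 4))\<^sup>2" "v $ 4 \<noteq> 0 \<Longrightarrow> 0 < (cmod (v $ 4))\<^sup>2"
      by simp_all
    ultimately show ?thesis unfolding form by linarith
  qed
  have "real_analytic_hypersurface (M2 \<inter> cylinder2) \<and> levi_nondegenerate (M2 \<inter> cylinder2) \<and>
      has_signature (M2 \<inter> cylinder2) 1"
    unfolding M
    by (rule levi_signature_of_graph[where J = "{1}" and k = 5], rule real_polynomial_rho2,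
        rule open_cylinder2, rule rho2_shift, simp, simp, simp, rule hermitian, (rule neg; assumption),
        (rule pos; assumption))
  then show "real_analytic_hypersurface (M2 \<inter> cylinder2)" "levi_nondegenerate (M2 \<inter> cylinder2)"
    "has_signature (M2 \<inter> cylinder2) 1"
    by blast+
qed

lemma connected_M1_cylinder1: "connected (M1 \<inter> cylinder1)"
proof -
  have "continuous_on cylinder1 (\<lambda>x. - rho1 x)"
    unfolding rho1_def by (intro continuous_intros)
  moreover have cyl: "cylinder1 = (\<lambda>x. x $ 1) -` ball 0 (1 / 2) \<inter> (\<lambda>x. x $ 2) -` ball 0 (1 / 2)"
    by (auto simp: cylinder1_def)
  have "convex cylinder1"
    unfolding cyl
    by (intro convex_Int convex_linear_vimage bounded_linear.linear[OF bounded_linear_vec_nth]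
        convex_ball)
  moreover have "x + s *\<^sub>R axis 4 (- \<i>) \<in> cylinder1" if "x \<in> cylinder1" for x s
    using that by (simp add: cylinder1_def axis_def)
  ultimately have "connected ({x. - rho1 x = 0} \<inter> cylinder1)"
    using rho1_shift by (intro connected_graph)
  then show ?thesis by (simp add: M1_def)
qed

lemma connected_M2_cylinder2: "connected (M2 \<inter> cylinder2)"
proof -
  have "continuous_on cylinder2 (\<lambda>x. - rho2 x)"
    unfolding rho2_def by (intro continuous_intros)
  moreover have cyl: "cylinder2 = (\<lambda>x. x $ 1) -` ball 0 (1 / sqrt 2)"
    by (auto simp: cylinder2_def)
  have "convex cylinder2"
    unfolding cyl
    by (intro convex_linear_vimage bounded_linear.linear[OF bounded_linear_vec_nth] convex_ball)
  moreover have "x + s *\<^sub>R axis 5 (- \<i>) \<in> cylinder2" if "x \<in> cylinder2" for x s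
    using that by (simp add: cylinder2_def axis_def)
  ultimately have "connected ({x. - rho2 x = 0} \<inter> cylinder2)"
    using rho2_shift by (intro connected_graph)
  then show ?thesis by (simp add: M2_def)
qed

section \<open>The map\<close>

definition holomorphic_at :: "(complex^'n \<Rightarrow> complex) \<Rightarrow> complex^'n \<Rightarrow> bool" where
  "holomorphic_at g x \<longleftrightarrow> (\<exists>D. (g has_derivative D) (at x) \<and> (\<forall>c v. D (c *s v) = c * D v))"

lemma holomorphic_at_intros:
  "holomorphic_at (\<lambda>x. a) x"
  "holomorphic_at (\<lambda>x. x $ k) x"
  "holomorphic_at f x \<Longrightarrow> holomorphic_at g x \<Longrightarrow> holomorphic_at (\<lambda>x. f x + g x) x"
  "holomorphic_at f x \<Longrightarrow> holomorphic_at g x \<Longrightarrow> holomorphic_at (\<lambda>x. f x - g x) x"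
  "holomorphic_at f x \<Longrightarrow> holomorphic_at g x \<Longrightarrow> holomorphic_at (\<lambda>x. f x * g x) x"
  "holomorphic_at f x \<Longrightarrow> holomorphic_at g x \<Longrightarrow> g x \<noteq> 0 \<Longrightarrow> holomorphic_at (\<lambda>x. f x / g x) x"
proof -
  show "holomorphic_at (\<lambda>x. a) x"
    unfolding holomorphic_at_def by (rule exI[of _ "\<lambda>_. 0"]) simp
  show "holomorphic_at (\<lambda>x. x $ k) x"
    unfolding holomorphic_at_def by (rule exI[of _ "\<lambda>v. v $ k"]) (simp add: has_derivative_coord)
  assume "holomorphic_at f x" "holomorphic_at g x"
  then obtain D E where D: "(f has_derivative D) (at x)" "\<And>c v. D (c *s v) = c * D v"
    and E: "(g has_derivative E) (at x)" "\<And>c v. E (c *s v) = c * E v"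
    unfolding holomorphic_at_def by blast
  show "holomorphic_at (\<lambda>x. f x + g x) x"
    unfolding holomorphic_at_def
    by (intro exI conjI, rule has_derivative_add[OF D(1) E(1)])
      (simp add: D(2) E(2) algebra_simps)
  show "holomorphic_at (\<lambda>x. f x - g x) x"
    unfolding holomorphic_at_def
    by (intro exI conjI, rule has_derivative_diff[OF D(1) E(1)])
      (simp add: D(2) E(2) algebra_simps)
  show "holomorphic_at (\<lambda>x. f x * g x) x"
    unfolding holomorphic_at_def
    by (intro exI conjI, rule has_derivative_mult[OF D(1) E(1)])
      (simp add: D(2) E(2) algebra_simps)
  assume "g x \<noteq> 0"
  then show "holomorphic_at (\<lambda>x. f x / g x) x"
    unfolding holomorphic_at_def
    by (intro exI conjI, rule has_derivative_divide[OF D(1) E(1)])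
      (simp_all add: D(2) E(2) field_simps)
qed

lemma holomorphic_map_onI:
  fixes F :: "complex^'n \<Rightarrow> complex^'m"
  assumes "open U" and F: "\<And>x i. x \<in> U \<Longrightarrow> holomorphic_at (\<lambda>x. F x $ i) x"
  shows "holomorphic_map_on F U"
  unfolding holomorphic_map_on_def
proof (intro conjI ballI assms(1))
  fix x assume "x \<in> U"
  then have "\<forall>i. \<exists>D. ((\<lambda>x. F x $ i) has_derivative D) (at x) \<and> (\<forall>c v. D (c *s v) = c * D v)"
    using F unfolding holomorphic_at_def by blast
  then obtain D where D: "\<And>i. ((\<lambda>x. F x $ i) has_derivative D i) (at x)"
      "\<And>i c v. D i (c *s v) = c * D i v"
    by metis
  have axis_linear: "bounded_linear (\<lambda>z :: complex. axis i z :: complex^'m)" for i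
    by (simp add: linear_conv_bounded_linear[symmetric] linear_iff vec_eq_iff axis_def)
  have expand: "(\<Sum>i\<in>UNIV. axis i (y i)) = (\<chi> i. y i)" for y :: "'m \<Rightarrow> complex"
    by (simp add: vec_eq_iff axis_def)
  have "((\<lambda>x. \<Sum>i\<in>UNIV. axis i (F x $ i)) has_derivative (\<lambda>v. \<Sum>i\<in>UNIV. axis i (D i v))) (at x)"
    by (intro has_derivative_sum bounded_linear.has_derivative[OF axis_linear] D)
  then have "(F has_derivative (\<lambda>v. \<chi> i. D i v)) (at x)"
    by (simp add: expand)
  moreover have "(\<chi> i. D i (c *s v)) = c *s (\<chi> i. D i v)" for c v
    by (simp add: D(2) vec_eq_iff)
  ultimately show "\<exists>D. (F has_derivative D) (at x) \<and> (\<forall>c v. D (c *s v) = c *s D v)"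
    by blast
qed

lemma norm_axis: "norm (axis k a :: complex^'n) = cmod a"
  by (simp add: norm_eq_sqrt_inner inner_axis_axis)

definition Fmap_domain :: "complex \<Rightarrow> (complex^4) set" where
  "Fmap_domain lam = {x. x $ 2 + lam \<noteq> 0 \<and> denom lam x \<noteq> 0}"

lemma open_Fmap_domain: "open (Fmap_domain lam)"
  unfolding Fmap_domain_def denom_def
  by (intro open_Collect_conj open_Collect_neq continuous_intros)

lemma zero_in_Fmap_domain:
  assumes "lam \<noteq> 0"
  shows "0 \<in> Fmap_domain lam"
proof -
  have "denom lam 0 = complex_of_real (1 + (cmod lam)\<^sup>2)" by (simp add: denom_def)
  moreover have "1 + (cmod lam)\<^sup>2 \<noteq> 0"
    using zero_le_power2[of "cmod lam"] by linarith
  ultimately have "denom lam 0 \<noteq> 0" by (simp only: of_real_eq_0_iff not_False_eq_True)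
  then show ?thesis using assms by (simp add: Fmap_domain_def)
qed

lemma Fmap_components:
  "Fmap lam x $ 1 = f1 lam x"
  "Fmap lam x $ 2 = 2 * (x $ 2 + lam) / denom lam x * f1 lam x"
  "Fmap lam x $ 3 = 2 * x $ 3 / denom lam x * f1 lam x"
  "Fmap lam x $ 4 = (1 + \<i> * x $ 4 - 2 * x $ 2 * cnj lam - complex_of_real ((cmod lam)\<^sup>2))
      / denom lam x * f1 lam x"
  "Fmap lam x $ 5 = 0"
  by (simp_all add: Fmap_def vector_def)

lemma holomorphic_Fmap: "holomorphic_map_on (Fmap lam) (Fmap_domain lam)"
proof (rule holomorphic_map_onI[OF open_Fmap_domain])
  fix x and i :: 5
  assume "x \<in> Fmap_domain lam"
  then have nz: "x $ 2 + lam \<noteq> 0" "denom lam x \<noteq> 0" by (auto simp: Fmap_domain_def)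
  have "holomorphic_at (denom lam) x"
    unfolding denom_def[abs_def] by (intro holomorphic_at_intros)
  moreover have "holomorphic_at (f1 lam) x"
    unfolding f1_def[abs_def] using nz by (intro holomorphic_at_intros) auto
  ultimately show "holomorphic_at (\<lambda>x. Fmap lam x $ i) x"
    using exhaust_5[of i] nz
    by (elim disjE; simp only: Fmap_components; intro holomorphic_at_intros)
qed

text \<open>The squared moduli of the components are rational in \<open>A = \<bar>z\<^sub>1\<bar>\<^sup>2\<close>, \<open>B = \<bar>z\<^sub>2 + \<lambda>\<bar>\<^sup>2\<close>, \<open>C = \<bar>D\<bar>\<^sup>2\<close>,
  \<open>\<bar>z\<^sub>3\<bar>\<^sup>2\<close> and \<open>\<bar>n\<bar>\<^sup>2\<close>, where \<open>D\<close> is the denominator and \<open>n\<close> the numerator of the fourth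
  component. Their only relation that enters is \<open>key\<close>, a consequence of
  \<open>D + n = 2\<close>.\<close>

lemma rho2_Fmap:
  assumes "x \<in> Fmap_domain lam"
  shows "rho2 (Fmap lam x) =
    2 * (cmod (x $ 1))\<^sup>2 / ((cmod (x $ 2 + lam))\<^sup>2 * (cmod (denom lam x))\<^sup>2) * rho1 x"
proof -
  define n where "n = 1 + \<i> * x $ 4 - 2 * x $ 2 * cnj lam - complex_of_real ((cmod lam)\<^sup>2)"
  define A where "A = (cmod (x $ 1))\<^sup>2"
  define B where "B = (cmod (x $ 2 + lam))\<^sup>2"
  define C where "C = (cmod (denom lam x))\<^sup>2"
  have nz: "B \<noteq> 0" "C \<noteq> 0" using assms by (auto simp: B_def C_def Fmap_domain_def)
  have F1: "(cmod (Fmap lam x $ 1))\<^sup>2 = A / (2 * B)"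
    by (simp add: Fmap_components f1_def norm_divide norm_mult power_divide power_mult_distrib
        A_def B_def)
  then have f1: "(cmod (f1 lam x))\<^sup>2 = A / (2 * B)" by (simp add: Fmap_components)
  have F2: "(cmod (Fmap lam x $ 2))\<^sup>2 = 4 * B / C * (A / (2 * B))"
    unfolding Fmap_components norm_mult norm_divide power_mult_distrib power_divide f1
    by (simp add: B_def C_def)
  have F3: "(cmod (Fmap lam x $ 3))\<^sup>2 = 4 * (cmod (x $ 3))\<^sup>2 / C * (A / (2 * B))"
    unfolding Fmap_components norm_mult norm_divide power_mult_distrib power_divide f1
    by (simp add: C_def)
  have F4: "(cmod (Fmap lam x $ 4))\<^sup>2 = (cmod n)\<^sup>2 / C * (A / (2 * B))"
    unfolding Fmap_components norm_mult norm_divide power_mult_distrib power_divide f1 n_def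
    by (simp add: C_def)
  have key: "C - (cmod n)\<^sup>2 - 4 * B - 4 * (cmod (x $ 3))\<^sup>2 + 4 * A = 4 * rho1 x"
    unfolding A_def B_def C_def n_def denom_def rho1_def cmod_power2
    by (simp add: power2_eq_square algebra_simps)
  have "rho2 (Fmap lam x) = A / (2 * B) - 4 * B / C * (A / (2 * B))
      - 4 * (cmod (x $ 3))\<^sup>2 / C * (A / (2 * B)) - (cmod n)\<^sup>2 / C * (A / (2 * B))
      + 2 * (A / (2 * B)) * (4 * B / C * (A / (2 * B)))"
    unfolding rho2_def F1 F2 F3 F4 by (simp add: Fmap_components)
  also have "\<dots> = A / (2 * B * C) * (C - (cmod n)\<^sup>2 - 4 * B - 4 * (cmod (x $ 3))\<^sup>2 + 4 * A)"
    using nz by (simp add: field_simps)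
  also have "\<dots> = 2 * A / (B * C) * rho1 x"
    unfolding key by simp
  finally show ?thesis unfolding A_def B_def C_def .
qed

lemma Fmap_into_M2:
  assumes "x \<in> M1" "x \<in> Fmap_domain lam"
  shows "Fmap lam x \<in> M2"
  using rho2_Fmap[OF assms(2)] assms(1) by (simp add: M1_def M2_def)

lemma Fmap_eq_0: "x $ 1 = 0 \<Longrightarrow> Fmap lam x = 0"
  unfolding vec_eq_iff
proof
  fix i assume "x $ 1 = 0"
  then show "Fmap lam x $ i = 0 $ i"
    using exhaust_5[of i] by (auto simp: Fmap_components f1_def)
qed

lemma T10_M2_zero: "v \<in> T10 M2 0 \<Longrightarrow> v $ 5 = 0"
proof -
  assume v: "v \<in> T10 M2 0"
  have deriv: "((\<lambda>X. Re (X $ k)) has_derivative (\<lambda>v. Re (v $ k))) (at X)"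
    "((\<lambda>X. Im (X $ k)) has_derivative (\<lambda>v. Im (v $ k))) (at X)" for k and X :: "complex^5"
    by (rule bounded_linear_imp_has_derivative[OF bounded_linear_Re_Im_coord(1)],
        rule bounded_linear_imp_has_derivative[OF bounded_linear_Re_Im_coord(2)])
  have "((\<lambda>X. - rho2 X) has_derivative (\<lambda>v. - Im (v $ 5))) (at 0)"
    unfolding rho2_def cmod_power2
    by (rule derivative_eq_intros deriv refl)+ (simp add: fun_eq_iff)
  then have "tangent_space ({X. - rho2 X = 0} \<inter> UNIV) 0 = {v. - Im (v $ 5) = 0}"
    by (rule tangent_space_level_set[OF _ _ _ _ rho2_shift]) (simp_all add: rho2_def)
  then have "tangent_space M2 0 = {v. Im (v $ 5) = 0}" by (simp add: M2_def)
  then show "v $ 5 = 0" using v by (simp add: T10_def complex_eq_iff)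
qed

lemma not_CR_transversal_Fmap:
  assumes "lam \<noteq> 0"
  shows "\<not> CR_transversal_at (Fmap lam) M2 0"
proof
  assume "CR_transversal_at (Fmap lam) M2 0"
  moreover have "Fmap lam 0 = 0" by (rule Fmap_eq_0) simp
  ultimately have "axis 5 1 \<in> {a + b | a b. a \<in> T10 M2 0 \<and>
      b \<in> range (frechet_derivative (Fmap lam) (at 0))}"
    by (simp add: CR_transversal_at_def)
  then obtain a b where ab: "axis 5 1 = a + b" "a \<in> T10 M2 0"
    "b \<in> range (frechet_derivative (Fmap lam) (at 0))"
    by blast
  obtain D where D: "(Fmap lam has_derivative D) (at 0)"
    using holomorphic_Fmap zero_in_Fmap_domain[OF assms] unfolding holomorphic_map_on_def by blast
  have "((\<lambda>x. Fmap lam x $ 5) has_derivative (\<lambda>v. D v $ 5)) (at 0)"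
    by (rule bounded_linear.has_derivative[OF bounded_linear_vec_nth D])
  then have "((\<lambda>x. 0) has_derivative (\<lambda>v. D v $ 5)) (at (0 :: complex^4))"
    unfolding Fmap_components .
  then have "(\<lambda>v. D v $ 5) = (\<lambda>_. 0)"
    using has_derivative_unique has_derivative_const by blast
  then have "b $ 5 = 0"
    using ab(3) frechet_derivative_at[OF D] by (metis imageE)
  then have "axis 5 1 $ 5 = (0 :: complex)"
    using arg_cong[OF ab(1), of "\<lambda>u. u $ 5"] T10_M2_zero[OF ab(2)] by simp
  then show False by simp
qed

text \<open>Points \<open>(\<epsilon>, 0, 0, 0)\<close> have \<open>\<rho>\<^sub>1 = \<epsilon>\<^sup>2\<close> and \<open>z\<^sub>1 \<noteq> 0\<close>, hence are mapped off \<open>M2\<close>.\<close>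

lemma not_totally_degenerate_Fmap:
  assumes "lam \<noteq> 0"
  shows "\<not> totally_degenerate_at (Fmap lam) M2 0"
proof
  assume "totally_degenerate_at (Fmap lam) M2 0"
  then obtain U where U: "open U" "0 \<in> U" "Fmap lam ` U \<subseteq> M2"
    unfolding totally_degenerate_at_def by blast
  have "open (U \<inter> Fmap_domain lam)" "0 \<in> U \<inter> Fmap_domain lam"
    using U open_Fmap_domain zero_in_Fmap_domain[OF assms] by auto
  then obtain e where e: "0 < e" "ball 0 e \<subseteq> U \<inter> Fmap_domain lam"
    by (meson openE)
  define x :: "complex^4" where "x = axis 1 (complex_of_real (e / 2))"
  have "norm x < e" using e(1) by (simp add: x_def norm_axis)
  then have x: "x \<in> U" "x \<in> Fmap_domain lam" using e(2) by auto
  have "rho1 x = (e / 2)\<^sup>2" using e(1) by (simp add: x_def rho1_def axis_def)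
  moreover have "x $ 1 \<noteq> 0" using e(1) by (simp add: x_def)
  ultimately have "rho2 (Fmap lam x) \<noteq> 0"
    using e(1) x(2) unfolding rho2_Fmap[OF x(2)] by (simp add: Fmap_domain_def)
  then show False using U(3) x(1) by (auto simp: M2_def)
qed

section \<open>The counterexample\<close>

text \<open>On \<open>M1\<close> the value of \<open>Im w\<close> exceeds \<open>-1/4\<close> because \<open>\<bar>z\<^sub>1\<bar> < 1/2\<close>, and this keeps the real part
  \<open>2 + Im w + 2 Re z\<^sub>2\<close> of the denominator positive however large \<open>z\<^sub>3\<close> and \<open>Re w\<close> are.\<close>

lemma M1_cylinder1_subset_domain: "M1 \<inter> cylinder1 \<subseteq> Fmap_domain 1"
  and Fmap_M1_cylinder1: "Fmap 1 ` (M1 \<inter> cylinder1) \<subseteq> M2 \<inter> cylinder2"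
proof -
  have bound: "cmod (x $ 1) < cmod (x $ 2 + 1)" and domain: "x \<in> Fmap_domain 1"
    if x: "x \<in> M1 \<inter> cylinder1" for x
  proof -
    have x12: "cmod (x $ 1) < 1 / 2" "cmod (x $ 2) < 1 / 2" using x by (auto simp: cylinder1_def)
    then show *: "cmod (x $ 1) < cmod (x $ 2 + 1)"
      using norm_diff_ineq[of 1 "x $ 2"] by (simp add: add.commute)
    have "(cmod (x $ 1))\<^sup>2 < (1 / 2)\<^sup>2" using x12 by (intro power_strict_mono) auto
    then have "(cmod (x $ 1))\<^sup>2 < 1 / 4" by (simp add: power_divide)
    moreover have "- cmod (x $ 2) \<le> Re (x $ 2)" using abs_Re_le_cmod[of "x $ 2"] by linarith
    moreover have "Im (x $ 4) = (cmod (x $ 2))\<^sup>2 + (cmod (x $ 3))\<^sup>2 - (cmod (x $ 1))\<^sup>2"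
      using x by (simp add: M1_def rho1_def)
    moreover have "0 \<le> (cmod (x $ 2))\<^sup>2" "0 \<le> (cmod (x $ 3))\<^sup>2" by simp_all
    moreover have "Re (denom 1 x) = 2 + Im (x $ 4) + 2 * Re (x $ 2)" by (simp add: denom_def)
    ultimately have "0 < Re (denom 1 x)" using x12 by linarith
    then have "denom 1 x \<noteq> 0" by auto
    moreover have "x $ 2 + 1 \<noteq> 0" using * by auto
    ultimately show "x \<in> Fmap_domain 1" by (simp add: Fmap_domain_def)
  qed
  show "M1 \<inter> cylinder1 \<subseteq> Fmap_domain 1" using domain by blast
  have "Fmap 1 x \<in> cylinder2" if x: "x \<in> M1 \<inter> cylinder1" for x
    using bound[OF x]
    by (simp add: cylinder2_def Fmap_components f1_def norm_divide norm_mult divide_simps)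
  then show "Fmap 1 ` (M1 \<inter> cylinder1) \<subseteq> M2 \<inter> cylinder2"
    using domain Fmap_into_M2 by blast
qed

text \<open>The points \<open>(0, 0, 0, t)\<close> with real \<open>t\<close> lie on \<open>M1\<close>, accumulate at the origin, and are all mapped
  to \<open>0\<close>.\<close>

lemma not_local_CR_embedding_Fmap: "\<not> local_CR_embedding (Fmap lam) (M1 \<inter> cylinder1) M'"
proof
  assume emb: "local_CR_embedding (Fmap lam) (M1 \<inter> cylinder1) M'"
  have axis_in: "axis 4 (complex_of_real t) \<in> M1 \<inter> cylinder1" for t
    by (simp add: M1_def rho1_def cylinder1_def axis_def)
  have "0 \<in> M1 \<inter> cylinder1" by (simp add: M1_def rho1_def cylinder1_def)
  from bspec[OF emb[unfolded local_CR_embedding_def] this]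
  have "\<exists>V. 0 \<in> V \<and> smooth_map_on (Fmap lam) V \<and> (\<exists>G. homeomorphism (M1 \<inter> cylinder1 \<inter> V)
      (Fmap lam ` (M1 \<inter> cylinder1 \<inter> V)) (Fmap lam) G)"
    by (rule ex_forward) (elim conjE, intro conjI)
  then obtain V G where V: "0 \<in> V" "smooth_map_on (Fmap lam) V"
    and G: "homeomorphism (M1 \<inter> cylinder1 \<inter> V) (Fmap lam ` (M1 \<inter> cylinder1 \<inter> V)) (Fmap lam) G"
    by blast
  have "open V" using V(2) by (simp add: smooth_map_on_def)
  then obtain e where e: "0 < e" "ball 0 e \<subseteq> V" using V(1) by (meson openE)
  define x :: "complex^4" where "x = axis 4 (complex_of_real (e / 2))"
  have "norm x < e" using e(1) by (simp add: x_def norm_axis)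
  then have "x \<in> V" using e(2) by auto
  moreover have "x \<in> M1 \<inter> cylinder1" unfolding x_def by (rule axis_in)
  ultimately have "x \<in> M1 \<inter> cylinder1 \<inter> V" by blast
  moreover have "0 \<in> M1 \<inter> cylinder1 \<inter> V" using V(1) \<open>0 \<in> M1 \<inter> cylinder1\<close> by blast
  moreover have "Fmap lam x = Fmap lam 0"
    using Fmap_eq_0[of x] Fmap_eq_0[of 0] by (simp add: x_def axis_def)
  ultimately have "x = 0" using G unfolding homeomorphism_def by metis
  then have "x $ 4 = 0" by simp
  then show False using e(1) by (simp add: x_def)
qed

lemma not_baouendi_huang_assertion: "\<not> baouendi_huang_assertion TYPE(4) TYPE(5)"
proof
  let ?M = "M1 \<inter> cylinder1" and ?M' = "M2 \<inter> cylinder2" and ?F = "Fmap 1"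
  assume "baouendi_huang_assertion TYPE(4) TYPE(5)"
  then have "real_analytic_hypersurface ?M \<and> connected ?M \<and> levi_nondegenerate ?M \<and>
      has_signature ?M 1 \<and> real_analytic_hypersurface ?M' \<and> connected ?M' \<and>
      levi_nondegenerate ?M' \<and> has_signature ?M' 1 \<and>
      (0::nat) < 1 \<and> real 1 \<le> (real CARD(4) - 1) / 2 \<and> 3 \<le> CARD(4) \<and> CARD(4) \<le> CARD(5) \<and>
      ?M \<subseteq> Fmap_domain 1 \<and> holomorphic_map_on ?F (Fmap_domain 1) \<and> ?F ` ?M \<subseteq> ?M' \<longrightarrow>
      local_CR_embedding ?F ?M ?M' \<or>
      (\<exists>U. open U \<and> ?M \<subseteq> U \<and> U \<subseteq> Fmap_domain 1 \<and> ?F ` U \<subseteq> ?M')"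
    unfolding baouendi_huang_assertion_def by blast
  then have "local_CR_embedding ?F ?M ?M' \<or>
      (\<exists>U. open U \<and> ?M \<subseteq> U \<and> U \<subseteq> Fmap_domain 1 \<and> ?F ` U \<subseteq> ?M')"
    using M1_signature[OF open_cylinder1] M2_signature connected_M1_cylinder1 connected_M2_cylinder2
      M1_cylinder1_subset_domain Fmap_M1_cylinder1 holomorphic_Fmap by simp
  then obtain U where U: "open U" "?M \<subseteq> U" "?F ` U \<subseteq> ?M'"
    using not_local_CR_embedding_Fmap by blast
  have "0 \<in> ?M" by (simp add: M1_def rho1_def cylinder1_def)
  then have "totally_degenerate_at ?F M2 0"
    using U unfolding totally_degenerate_at_def by blast
  then show False using not_totally_degenerate_Fmap[of 1] by simp
qed

theorem mainTheorem2:
  shows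
    "(\<exists>U. open U \<and> 0 \<in> U \<and> real_analytic_hypersurface (M1 \<inter> U) \<and>
        levi_nondegenerate (M1 \<inter> U) \<and> has_signature (M1 \<inter> U) 1) \<and>
     (\<exists>U. open U \<and> 0 \<in> U \<and> real_analytic_hypersurface (M2 \<inter> U) \<and>
        levi_nondegenerate (M2 \<inter> U) \<and> has_signature (M2 \<inter> U) 1) \<and>
     (\<forall>lam :: complex. lam \<noteq> 0 \<longrightarrow>
        (\<exists>\<Omega>. open \<Omega> \<and> 0 \<in> \<Omega> \<and> holomorphic_map_on (Fmap lam) \<Omega> \<and>
           (\<forall>x\<in>\<Omega>. x $ 2 + lam \<noteq> 0 \<and> denom lam x \<noteq> 0 \<and>
              rho2 (Fmap lam x) =
                2 * (cmod (x $ 1))\<^sup>2 / ((cmod (x $ 2 + lam))\<^sup>2 * (cmod (denom lam x))\<^sup>2) * rho1 x) \<and>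
           Fmap lam ` (M1 \<inter> \<Omega>) \<subseteq> M2) \<and>
        \<not> CR_transversal_at (Fmap lam) M2 0 \<and>
        \<not> totally_degenerate_at (Fmap lam) M2 0) \<and>
     \<not> baouendi_huang_assertion TYPE(4) TYPE(5)"
proof (intro conjI allI impI)
  show "\<exists>U. open U \<and> 0 \<in> U \<and> real_analytic_hypersurface (M1 \<inter> U) \<and>
      levi_nondegenerate (M1 \<inter> U) \<and> has_signature (M1 \<inter> U) 1"
    using M1_signature[OF open_UNIV] by (intro exI[of _ UNIV]) simp
  show "\<exists>U. open U \<and> 0 \<in> U \<and> real_analytic_hypersurface (M2 \<inter> U) \<and>
      levi_nondegenerate (M2 \<inter> U) \<and> has_signature (M2 \<inter> U) 1"
    using M2_signature open_cylinder2 by (intro exI[of _ cylinder2]) (simp add: cylinder2_def)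
  show "\<not> baouendi_huang_assertion TYPE(4) TYPE(5)"
    by (rule not_baouendi_huang_assertion)
  fix lam :: complex assume lam: "lam \<noteq> 0"
  show "\<not> CR_transversal_at (Fmap lam) M2 0" by (rule not_CR_transversal_Fmap[OF lam])
  show "\<not> totally_degenerate_at (Fmap lam) M2 0" by (rule not_totally_degenerate_Fmap[OF lam])
  show "\<exists>\<Omega>. open \<Omega> \<and> 0 \<in> \<Omega> \<and> holomorphic_map_on (Fmap lam) \<Omega> \<and>
      (\<forall>x\<in>\<Omega>. x $ 2 + lam \<noteq> 0 \<and> denom lam x \<noteq> 0 \<and>
        rho2 (Fmap lam x) =
          2 * (cmod (x $ 1))\<^sup>2 / ((cmod (x $ 2 + lam))\<^sup>2 * (cmod (denom lam x))\<^sup>2) * rho1 x) \<and>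
      Fmap lam ` (M1 \<inter> \<Omega>) \<subseteq> M2"
    using open_Fmap_domain zero_in_Fmap_domain[OF lam] holomorphic_Fmap rho2_Fmap Fmap_into_M2
    by (intro exI[of _ "Fmap_domain lam"]) (auto simp: Fmap_domain_def)
qed

end
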